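(* Let $V$ be a connected braided vector space of diagonal type of rank $n$, $n>1$, with braiding matrix $(q_{ij})_{n\times n}$. Then the generalized Dynkin diagram of $V$ is a complete diagram (i.e. $q_{ij}q_{ji}\neq 1$ for all $1\le i\neq j\le n$) and $q_{ii}\neq 1$ for every $1\le i\le n$ if and only if $\mathfrak B(V)=F\oplus\mathfrak L(V)$.
   Context: $F$ is a field of characteristic zero. $V$ is a vector space over $F$ with basis $x_1,\dots,x_n$ ($n>1$; $n$ is the rank), with braiding of diagonal type $C(x_i\otimes x_j)=q_{ij}\,x_j\otimes x_i$, $q_{ij}\in F\setminus\{0\}$. The generalized Dynkin diagram of $V$ is the graph on $\{1,\dots,n\}$ with an edge between $i\neq j$ exactly when $q_{ij}q_{ji}\neq 1$ (vertices labelled by $q_{ii}$, edges by $q_{ij}q_{ji}$); $V$ is connected if this graph is connected, and the diagram is complete if there is an edge between any two vertices. $\mathfrak B(V)$ is the Nichols algebra of $(V,C)$, i.e. the quotient of the tensor algebra $T(V)$ by the sum of the kernels of the quantum symmetrizers; it is $\mathbb N_0^n$-graded with $\deg x_i=e_i$, and "homogeneous" refers to this grading. For homogeneous $u,v$ of degrees $\alpha,\beta$ put $p_{uv}=\prod_{i,j}q_{ij}^{\alpha_i\beta_j}$. The braided bracket on $\mathfrak B(V)$ is the bilinear extension of $[x,y]=yx-p_{yx}xy$ ($x,y$ homogeneous). $\mathfrak L(V)$ is the smallest subspace of $\mathfrak B(V)$ containing $V$ and closed under $[\ ,\ ]$. $F$ also denotes the degree-zero part $F\cdot 1$ of $\mathfrak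 B(V)$. *)

theory Defs
  imports
    "HOL-Library.Cardinality"
    "HOL-Library.Poly_Mapping"
    "HOL-Combinatorics.Permutations"
    "HOL-Algebra.QuotRing"
begin

section \<open>The tensor algebra\<close>

text \<open>
  Words under concatenation are the free monoid. With this instance the convolution product of
  \<^theory>\<open>HOL-Library.Poly_Mapping\<close> makes finitely supported functions on words over an index
  type \<open>'i\<close> into the tensor algebra \<open>T(V)\<close> of the vector space \<open>V\<close> with basis
  \<open>(x\<^sub>i)\<close> indexed by \<open>'i\<close>; the word \<open>[i\<^sub>1, \<dots>, i\<^sub>m]\<close> is
  \<open>x\<^bsub>i\<^sub>1\<^esub> \<otimes> \<dots> \<otimes> x\<^bsub>i\<^sub>m\<^esub>\<close>.
\<close>

instantiation list :: (type) monoid_add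
begin

definition zero_list :: "'a list" where "zero_list = []"

definition plus_list :: "'a list \<Rightarrow> 'a list \<Rightarrow> 'a list" where "plus_list = (@)"

instance
  by standard (simp_all add: zero_list_def plus_list_def)

end

type_synonym ('i, 'a) tensor_algebra = "'i list \<Rightarrow>\<^sub>0 'a"

definition tensor_scalar :: "'a::field \<Rightarrow> ('i, 'a) tensor_algebra" where
  "tensor_scalar c = Poly_Mapping.single [] c"

definition tensor_word :: "'i list \<Rightarrow> ('i, 'a::field) tensor_algebra" where
  "tensor_word w = Poly_Mapping.single w 1"

definition tensor_power :: "nat \<Rightarrow> ('i, 'a::field) tensor_algebra set" where
  "tensor_power m = {u. \<forall>w\<in>Poly_Mapping.keys u. length w = m}"

definition linear_extension ::
  "('i list \<Rightarrow> ('i, 'a::field) tensor_algebra) \<Rightarrow> ('i, 'a) tensor_algebra \<Rightarrow> ('i, 'a) tensor_algebra" where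
  "linear_extension f u =
     (\<Sum>w\<in>Poly_Mapping.keys u. tensor_scalar (Poly_Mapping.lookup u w) * f w)"

section \<open>The braiding and the quantum symmetrizers\<close>

definition braiding :: "('i \<Rightarrow> 'i \<Rightarrow> 'a::field) \<Rightarrow> 'i \<Rightarrow> 'i \<Rightarrow> ('i, 'a) tensor_algebra" where
  "braiding q i j = tensor_scalar (q i j) * tensor_word [j, i]"

text \<open>
  \<open>C\<close> applied to the (zero-based) tensor positions \<open>k\<close> and \<open>k + 1\<close>; only
  meaningful on tensors of degree greater than \<open>k + 1\<close>.
\<close>

definition braiding_at ::
  "('i \<Rightarrow> 'i \<Rightarrow> 'a::field) \<Rightarrow> nat \<Rightarrow> ('i, 'a) tensor_algebra \<Rightarrow> ('i, 'a) tensor_algebra" where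
  "braiding_at q k = linear_extension
     (\<lambda>w. tensor_word (take k w) * braiding q (w ! k) (w ! Suc k) * tensor_word (drop (k + 2) w))"

text \<open>
  A list \<open>[k\<^sub>1, \<dots>, k\<^sub>l]\<close> expresses \<open>\<sigma>\<close> if \<open>\<sigma>\<close> is the product of the simple
  transpositions exchanging \<open>k\<^sub>i\<close> and \<open>k\<^sub>i + 1\<close>.
\<close>

definition expresses :: "nat \<Rightarrow> (nat \<Rightarrow> nat) \<Rightarrow> nat list \<Rightarrow> bool" where
  "expresses m \<sigma> ks \<longleftrightarrow>
     (\<forall>k\<in>set ks. Suc k < m) \<and> foldr (\<lambda>k \<tau>. transpose k (Suc k) \<circ> \<tau>) ks id = \<sigma>"

definition reduced_expression :: "nat \<Rightarrow> (nat \<Rightarrow> nat) \<Rightarrow> nat list \<Rightarrow> bool" where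
  "reduced_expression m \<sigma> ks \<longleftrightarrow> is_arg_min length (expresses m \<sigma>) ks"

text \<open>
  The operator \<open>T\<^sub>\<sigma>\<close>: the product of the braidings along a reduced expression of \<open>\<sigma>\<close>. By the
  braid relations it does not depend on the reduced expression that is chosen.
\<close>

definition braid_lift ::
  "('i \<Rightarrow> 'i \<Rightarrow> 'a::field) \<Rightarrow> nat \<Rightarrow> (nat \<Rightarrow> nat) \<Rightarrow> ('i, 'a) tensor_algebra \<Rightarrow> ('i, 'a) tensor_algebra" where
  "braid_lift q m \<sigma> =
     foldr (\<lambda>k f. braiding_at q k \<circ> f) (SOME ks. reduced_expression m \<sigma> ks) id"

definition quantum_symmetrizer ::
  "('i \<Rightarrow> 'i \<Rightarrow> 'a::field) \<Rightarrow> nat \<Rightarrow> ('i, 'a) tensor_algebra \<Rightarrow> ('i, 'a) tensor_algebra" where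
  "quantum_symmetrizer q m u = (\<Sum>\<sigma> | \<sigma> permutes {..<m}. braid_lift q m \<sigma> u)"

definition symmetrizer_kernel :: "('i \<Rightarrow> 'i \<Rightarrow> 'a::field) \<Rightarrow> nat \<Rightarrow> ('i, 'a) tensor_algebra set" where
  "symmetrizer_kernel q m = {u \<in> tensor_power m. quantum_symmetrizer q m u = 0}"

section \<open>The Nichols algebra\<close>

definition tensor_ring :: "('i, 'a::field) tensor_algebra ring" where
  "tensor_ring = \<lparr>carrier = UNIV, mult = (*), one = 1, zero = 0, add = (+)\<rparr>"

definition nichols_ideal :: "('i \<Rightarrow> 'i \<Rightarrow> 'a::field) \<Rightarrow> ('i, 'a) tensor_algebra set" where
  "nichols_ideal q = {\<Sum>m<N. f m | f N. \<forall>m. f m \<in> symmetrizer_kernel q m}"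

definition nichols_algebra :: "('i \<Rightarrow> 'i \<Rightarrow> 'a::field) \<Rightarrow> ('i, 'a) tensor_algebra set ring" where
  "nichols_algebra q = tensor_ring Quot nichols_ideal q"

definition nichols_proj ::
  "('i \<Rightarrow> 'i \<Rightarrow> 'a::field) \<Rightarrow> ('i, 'a) tensor_algebra \<Rightarrow> ('i, 'a) tensor_algebra set" where
  "nichols_proj q u = nichols_ideal q +>\<^bsub>tensor_ring\<^esub> u"

definition nichols_scalar :: "('i \<Rightarrow> 'i \<Rightarrow> 'a::field) \<Rightarrow> 'a \<Rightarrow> ('i, 'a) tensor_algebra set" where
  "nichols_scalar q c = nichols_proj q (tensor_scalar c)"

section \<open>The braided bracket\<close>

definition word_degree :: "'i list \<Rightarrow> 'i \<Rightarrow> nat" where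
  "word_degree w = count_list w"

definition homogeneous :: "('i \<Rightarrow> nat) \<Rightarrow> ('i, 'a::field) tensor_algebra set" where
  "homogeneous \<alpha> = {u. \<forall>w\<in>Poly_Mapping.keys u. word_degree w = \<alpha>}"

definition bicharacter ::
  "('i::finite \<Rightarrow> 'i \<Rightarrow> 'a::field) \<Rightarrow> ('i \<Rightarrow> nat) \<Rightarrow> ('i \<Rightarrow> nat) \<Rightarrow> 'a" where
  "bicharacter q \<alpha> \<beta> = (\<Prod>i\<in>UNIV. \<Prod>j\<in>UNIV. q i j ^ (\<alpha> i * \<beta> j))"

text \<open>
  The bilinear extension of \<open>[x, y] = y x - p\<^bsub>yx\<^esub> x y\<close> to the tensor algebra, given by its values
  on the basis of words; \<open>tensor_bracket_homogeneous\<close> below gives its values on all homogeneous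
  elements.
\<close>

definition tensor_bracket ::
  "('i::finite \<Rightarrow> 'i \<Rightarrow> 'a::field) \<Rightarrow> ('i, 'a) tensor_algebra \<Rightarrow> ('i, 'a) tensor_algebra
     \<Rightarrow> ('i, 'a) tensor_algebra" where
  "tensor_bracket q u v =
     linear_extension (\<lambda>x. linear_extension (\<lambda>y.
         tensor_word y * tensor_word x
         - tensor_scalar (bicharacter q (word_degree y) (word_degree x))
             * (tensor_word x * tensor_word y)) v) u"

text \<open>
  Since the defining ideal is two-sided and homogeneous for the grading by
  \<open>'i \<Rightarrow> nat\<close>, the bracket descends to the quotient. As in \<^const>\<open>rcoset_mult\<close> the bracket of two
  cosets is the union of the cosets of the brackets of their elements.
\<close>

definition nichols_bracket ::
  "('i::finite \<Rightarrow> 'i \<Rightarrow> 'a::field) \<Rightarrow> ('i, 'a) tensor_algebra set \<Rightarrow> ('i, 'a) tensor_algebra set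
     \<Rightarrow> ('i, 'a) tensor_algebra set" where
  "nichols_bracket q X Y = (\<Union>u\<in>X. \<Union>v\<in>Y. nichols_proj q (tensor_bracket q u v))"

text \<open>The smallest subspace containing \<open>V\<close> and closed under the bracket.\<close>

inductive_set nichols_lie :: "('i::finite \<Rightarrow> 'i \<Rightarrow> 'a::field) \<Rightarrow> ('i, 'a) tensor_algebra set set"
  for q :: "'i::finite \<Rightarrow> 'i \<Rightarrow> 'a::field" where
  generator: "v \<in> tensor_power 1 \<Longrightarrow> nichols_proj q v \<in> nichols_lie q"
| zero: "\<zero>\<^bsub>nichols_algebra q\<^esub> \<in> nichols_lie q"
| add: "X \<in> nichols_lie q \<Longrightarrow> Y \<in> nichols_lie q \<Longrightarrow> X \<oplus>\<^bsub>nichols_algebra q\<^esub> Y \<in> nichols_lie q"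
| scale: "X \<in> nichols_lie q \<Longrightarrow> nichols_scalar q c \<otimes>\<^bsub>nichols_algebra q\<^esub> X \<in> nichols_lie q"
| bracket: "X \<in> nichols_lie q \<Longrightarrow> Y \<in> nichols_lie q \<Longrightarrow> nichols_bracket q X Y \<in> nichols_lie q"

definition internal_direct_sum :: "('b, 'c) ring_scheme \<Rightarrow> 'b set \<Rightarrow> 'b set \<Rightarrow> bool" where
  "internal_direct_sum R U W \<longleftrightarrow> carrier R = U <+>\<^bsub>R\<^esub> W \<and> U \<inter> W = {\<zero>\<^bsub>R\<^esub>}"

section \<open>The generalized Dynkin diagram\<close>

definition dynkin_edge :: "('i \<Rightarrow> 'i \<Rightarrow> 'a::field) \<Rightarrow> 'i \<Rightarrow> 'i \<Rightarrow> bool" where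
  "dynkin_edge q i j \<longleftrightarrow> i \<noteq> j \<and> q i j * q j i \<noteq> 1"

definition connected_diagram :: "('i \<Rightarrow> 'i \<Rightarrow> 'a::field) \<Rightarrow> bool" where
  "connected_diagram q \<longleftrightarrow> (\<forall>i j. (dynkin_edge q)\<^sup>*\<^sup>* i j)"

definition complete_diagram :: "('i \<Rightarrow> 'i \<Rightarrow> 'a::field) \<Rightarrow> bool" where
  "complete_diagram q \<longleftrightarrow> (\<forall>i j. i \<noteq> j \<longrightarrow> dynkin_edge q i j)"

section \<open>The bracket on homogeneous elements\<close>

lemma linear_extension_word: "linear_extension tensor_word u = u"
proof -
  have "linear_extension tensor_word u
      = (\<Sum>w\<in>Poly_Mapping.keys u. Poly_Mapping.single w (Poly_Mapping.lookup u w))"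
    unfolding linear_extension_def
    by (intro sum.cong refl)
       (simp add: tensor_scalar_def tensor_word_def mult_single plus_list_def)
  also have "\<dots> = u"
    by (rule poly_mapping_eqI)
       (simp add: lookup_sum lookup_single when_def in_keys_iff sum.delta)
  finally show ?thesis .
qed

lemma tensor_scalar_commute:
  fixes u :: "('i, 'a::field) tensor_algebra"
  shows "tensor_scalar c * u = u * tensor_scalar c"
proof -
  have 1: "tensor_scalar c * tensor_word w = (tensor_word w * tensor_scalar c :: ('i, 'a) tensor_algebra)"
    for w
    by (simp add: tensor_scalar_def tensor_word_def mult_single plus_list_def)
  have 2: "tensor_scalar c * tensor_scalar d = (tensor_scalar d * tensor_scalar c :: ('i, 'a) tensor_algebra)"
    for d
    by (simp add: tensor_scalar_def mult_single plus_list_def mult.commute)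
  have "tensor_scalar c * linear_extension tensor_word u
      = linear_extension tensor_word u * tensor_scalar c"
    unfolding linear_extension_def sum_distrib_left sum_distrib_right
    by (intro sum.cong refl) (metis 1 2 mult.assoc)
  then show ?thesis
    by (simp add: linear_extension_word)
qed

lemma linear_extension_mult_left:
  "linear_extension (\<lambda>w. a * f w) u = a * linear_extension f u"
  unfolding linear_extension_def sum_distrib_left
  by (intro sum.cong refl) (metis mult.assoc tensor_scalar_commute)

lemma linear_extension_mult_right:
  "linear_extension (\<lambda>w. f w * a) u = linear_extension f u * a"
  unfolding linear_extension_def sum_distrib_right by (simp add: mult.assoc)

lemma linear_extension_diff:
  "linear_extension (\<lambda>w. f w - g w) u = linear_extension f u - linear_extension g u"
  unfolding linear_extension_def by (simp add: right_diff_distrib sum_subtractf)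

lemma linear_extension_cong:
  "(\<And>w. w \<in> Poly_Mapping.keys u \<Longrightarrow> f w = g w) \<Longrightarrow> linear_extension f u = linear_extension g u"
  unfolding linear_extension_def by simp

lemma tensor_bracket_homogeneous:
  assumes "u \<in> homogeneous \<alpha>" "v \<in> homogeneous \<beta>"
  shows "tensor_bracket q u v = v * u - tensor_scalar (bicharacter q \<beta> \<alpha>) * (u * v)"
proof -
  have "tensor_bracket q u v = linear_extension (\<lambda>x. linear_extension (\<lambda>y.
         tensor_word y * tensor_word x
         - tensor_scalar (bicharacter q \<beta> \<alpha>) * (tensor_word x * tensor_word y)) v) u"
    unfolding tensor_bracket_def using assms
    by (intro linear_extension_cong) (simp add: homogeneous_def)
  then show ?thesis
    by (simp add: linear_extension_diff linear_extension_mult_left linear_extension_mult_right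
        linear_extension_word)
qed

end

theory Submission
  imports Defs "HOL-Combinatorics.Multiset_Permutations"
begin

text \<open>
  The operator \<open>T\<^sub>\<sigma>\<close> sends a word to its permutation by \<open>\<sigma>\<close>, multiplied by one factor
  \<open>q\<^sub>i\<^sub>j\<close> for every inversion. Hence an element lies in the defining ideal iff, for every finite set
  of positions and every labelling of the positions by indices, the weighted sum of its coefficients
  over the orderings of the positions vanishes. Splitting off the first or the last position shows
  that this ideal is two-sided.

  Suppose \<open>q\<^sub>i\<^sub>j q\<^sub>j\<^sub>i = 1\<close>, where \<open>i \<noteq> j\<close> or \<open>q\<^sub>i\<^sub>i = 1\<close>. The functional
  \<open>u \<mapsto> u\<^bsub>ij\<^esub> + q\<^sub>j\<^sub>i u\<^bsub>ji\<^esub>\<close> on coefficients vanishes on the ideal and on all brackets of elements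
  without constant term, but not on \<open>x\<^sub>i x\<^sub>j\<close>, so this monomial is not in \<open>F + L(V)\<close>.

  Conversely, every nonempty word is in \<open>L(V)\<close>, by induction on its length. Modulo \<open>L(V)\<close>, the word
  \<open>x\<^sub>i x\<^sub>j v\<close> becomes a multiple of \<open>v x\<^sub>i x\<^sub>j\<close> either by moving \<open>x\<^sub>i\<close> and then \<open>x\<^sub>j\<close> to the end, or by
  moving \<open>x\<^sub>i x\<^sub>j\<close> at once; the two factors differ by \<open>q\<^sub>i\<^sub>j q\<^sub>j\<^sub>i\<close>. If this is \<open>1\<close>, then \<open>i = j\<close> and
  \<open>q\<^sub>i\<^sub>i = -1\<close>, so that \<open>x\<^sub>i\<^sup>2 = 0\<close> in the Nichols algebra.
\<close>

section \<open>Reduced expressions and inversions\<close>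

text \<open>The list orders a set of positions and \<open>w\<close> labels them; every larger
  position standing before a smaller one contributes a factor. Positions are arbitrary naturals
  rather than an initial segment, so that one can later be deleted without renumbering.\<close>

fun braid_weight :: "('i \<Rightarrow> 'i \<Rightarrow> 'a::field) \<Rightarrow> (nat \<Rightarrow> 'i) \<Rightarrow> nat list \<Rightarrow> 'a" where
  "braid_weight q w [] = 1"
| "braid_weight q w (p # ps) = (\<Prod>r | r \<in> set ps \<and> r < p. q (w p) (w r)) * braid_weight q w ps"

definition inversions :: "nat \<Rightarrow> (nat \<Rightarrow> nat) \<Rightarrow> (nat \<times> nat) set" where
  "inversions m \<sigma> = {(s, t). s < t \<and> t < m \<and> \<sigma> t < \<sigma> s}"

lemma finite_inversions [simp]: "finite (inversions m \<sigma>)"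
  by (rule finite_subset[of _ "{..<m} \<times> {..<m}"]) (auto simp: inversions_def)

lemma inversions_id [simp]: "inversions m id = {}"
  by (auto simp: inversions_def)

lemma prod_Un_image_map_prod_Suc:
  fixes g :: "nat \<times> nat \<Rightarrow> 'b::comm_monoid_mult"
  assumes "finite A" "finite B" "A \<inter> map_prod Suc Suc ` B = {}"
  shows "(\<Prod>x\<in>A \<union> map_prod Suc Suc ` B. g x) = (\<Prod>x\<in>A. g x) * (\<Prod>x\<in>B. g (map_prod Suc Suc x))"
proof -
  have "inj_on (map_prod Suc Suc) B"
    by (auto simp: inj_on_def)
  then show ?thesis
    using assms by (simp add: prod.union_disjoint prod.reindex)
qed

lemma braid_weight_eq_prod_inversions:
  assumes "distinct ps"
  shows "braid_weight q w ps = (\<Prod>(s, t)\<in>inversions (length ps) (nth ps). q (w (ps ! s)) (w (ps ! t)))"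
  using assms
proof (induction ps)
  case Nil
  then show ?case by (simp add: inversions_def)
next
  case (Cons p ps)
  \<comment> \<open>\<open>J\<close> indexes the inversions of the head with later entries; the
    remaining inversions are those of the tail with both indices shifted by one.\<close>
  define J where "J = {t. t < length ps \<and> ps ! t < p}"
  have split: "inversions (length (p # ps)) (nth (p # ps))
      = (\<lambda>t. (0, Suc t)) ` J \<union> map_prod Suc Suc ` inversions (length ps) (nth ps)"
  proof (rule Set.set_eqI)
    fix x :: "nat \<times> nat"
    obtain s t where "x = (s, t)"
      by (cases x)
    then show "x \<in> inversions (length (p # ps)) (nth (p # ps)) \<longleftrightarrow>
      x \<in> (\<lambda>t. (0, Suc t)) ` J \<union> map_prod Suc Suc ` inversions (length ps) (nth ps)"
      by (cases s; cases t) (auto simp: inversions_def J_def image_iff)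
  qed
  have set: "{r. r \<in> set ps \<and> r < p} = nth ps ` J"
    by (auto simp: J_def in_set_conv_nth)
  have "inj_on (nth ps) J"
    using Cons.prems by (auto simp: J_def inj_on_def nth_eq_iff_index_eq)
  then have "(\<Prod>r | r \<in> set ps \<and> r < p. q (w p) (w r)) = (\<Prod>t\<in>J. q (w p) (w (ps ! t)))"
    by (simp add: set prod.reindex)
  moreover have "finite J"
    by (simp add: J_def)
  ultimately show ?case
    using Cons unfolding split
    by (subst prod_Un_image_map_prod_Suc) (auto simp: prod.reindex inj_on_def case_prod_unfold)
qed

text \<open>The last entry is inverted exactly with the larger entries before it. This mirrors the
  recursion of \<open>braid_weight\<close> at the other end; closure of the ideal under right
  multiplication rests on it.\<close>

lemma braid_weight_snoc:
  assumes "distinct (ps @ [p])"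
  shows "braid_weight q w (ps @ [p]) = braid_weight q w ps * (\<Prod>r | r \<in> set ps \<and> p < r. q (w r) (w p))"
  using assms
proof (induction ps)
  case Nil
  then show ?case by simp
next
  case (Cons a ps)
  have 1: "{r. r \<in> set (ps @ [p]) \<and> r < a}
      = (if p < a then insert p {r. r \<in> set ps \<and> r < a} else {r. r \<in> set ps \<and> r < a})"
    by auto
  have 2: "{r. r \<in> set (a # ps) \<and> p < r}
      = (if p < a then insert a {r. r \<in> set ps \<and> p < r} else {r. r \<in> set ps \<and> p < r})"
    by auto
  have IH: "braid_weight q w (ps @ [p])
      = braid_weight q w ps * (\<Prod>r | r \<in> set ps \<and> p < r. q (w r) (w p))"
    using Cons by simp
  show ?case
    using Cons.prems
    by (simp only: append_Cons braid_weight.simps 1 2 IH) (auto simp: algebra_simps)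
qed

text \<open>Only comparisons between positions enter the weight, so a strictly increasing
  relabelling preserves it.\<close>

lemma braid_weight_map:
  assumes "strict_mono_on (set ps) e"
  shows "braid_weight q w (map e ps) = braid_weight q (w \<circ> e) ps"
  using assms
proof (induction ps)
  case Nil
  then show ?case by simp
next
  case (Cons a ps)
  have "strict_mono_on (set ps) e"
    using Cons.prems by (auto simp: strict_mono_on_def)
  moreover have inj: "inj_on e (set ps)"
    using Cons.prems by (metis calculation strict_mono_on_imp_inj_on)
  moreover have "{r. r \<in> set (map e ps) \<and> r < e a} = e ` {r. r \<in> set ps \<and> r < a}"
    using strict_mono_on_less[OF Cons.prems] by auto
  moreover have "inj_on e {r. r \<in> set ps \<and> r < a}"
    using inj by (rule inj_on_subset) auto
  ultimately show ?case
    using Cons.IH by (simp add: prod.reindex)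
qed

text \<open>Left composition with a simple transposition exchanges two adjacent values, so only the
  pair of arguments carrying these two values can change its order.\<close>

lemma inversions_transpose_comp:
  assumes \<tau>: "\<tau> permutes {..<m}"
  shows "inversions m (Transposition.transpose k (Suc k) \<circ> \<tau>)
      \<subseteq> insert (Hilbert_Choice.inv \<tau> k, Hilbert_Choice.inv \<tau> (Suc k)) (inversions m \<tau>)"
proof clarify
  fix s t
  assume st: "(s, t) \<in> inversions m (Transposition.transpose k (Suc k) \<circ> \<tau>)"
    and no: "(s, t) \<notin> inversions m \<tau>"
  then have "s < t" "t < m" "\<tau> s \<noteq> \<tau> t"
    using permutes_inj[OF \<tau>] by (auto simp: inversions_def dest: injD)
  then have "\<tau> s < \<tau> t" "Transposition.transpose k (Suc k) (\<tau> t) < Transposition.transpose k (Suc k) (\<tau> s)"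
    using st no by (auto simp: inversions_def)
  then have "\<tau> s = k" "\<tau> t = Suc k"
    by (auto simp: Transposition.transpose_def split: if_splits)
  then show "s = Hilbert_Choice.inv \<tau> k \<and> t = Hilbert_Choice.inv \<tau> (Suc k)"
    using permutes_inverses(2)[OF \<tau>] by metis
qed

text \<open>If the value \<open>k\<close> is attained before \<open>Suc k\<close>, the exchange
  creates exactly this inversion and destroys none.\<close>

lemma inversions_transpose_comp_less:
  assumes \<tau>: "\<tau> permutes {..<m}" and k: "Suc k < m" and less: "Hilbert_Choice.inv \<tau> k < Hilbert_Choice.inv \<tau> (Suc k)"
  shows "inversions m (Transposition.transpose k (Suc k) \<circ> \<tau>)
      = insert (Hilbert_Choice.inv \<tau> k, Hilbert_Choice.inv \<tau> (Suc k)) (inversions m \<tau>)"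
    and "(Hilbert_Choice.inv \<tau> k, Hilbert_Choice.inv \<tau> (Suc k)) \<notin> inversions m \<tau>"
proof -
  have inv: "\<tau> (Hilbert_Choice.inv \<tau> a) = a" "Hilbert_Choice.inv \<tau> (\<tau> a) = a" for a
    using permutes_inverses[OF \<tau>] by auto
  have m: "Hilbert_Choice.inv \<tau> (Suc k) < m"
    using permutes_in_image[OF permutes_inv[OF \<tau>], of "Suc k"] k by auto
  show "inversions m (Transposition.transpose k (Suc k) \<circ> \<tau>)
      = insert (Hilbert_Choice.inv \<tau> k, Hilbert_Choice.inv \<tau> (Suc k)) (inversions m \<tau>)"
  proof (rule equalityI[OF inversions_transpose_comp[OF \<tau>]], clarify)
    fix s t
    assume a: "(s, t) \<in> insert (Hilbert_Choice.inv \<tau> k, Hilbert_Choice.inv \<tau> (Suc k)) (inversions m \<tau>)"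
    show "(s, t) \<in> inversions m (Transposition.transpose k (Suc k) \<circ> \<tau>)"
    proof (cases "(s, t) \<in> inversions m \<tau>")
      case False
      then show ?thesis
        using a less m by (auto simp: inversions_def inv)
    next
      case True
      then have st: "s < t" "t < m" "\<tau> t < \<tau> s"
        by (auto simp: inversions_def)
      have "\<not> (\<tau> t = k \<and> \<tau> s = Suc k)"
        using st less inv by (metis less_asym)
      then have "Transposition.transpose k (Suc k) (\<tau> t) < Transposition.transpose k (Suc k) (\<tau> s)"
        using st by (auto simp: Transposition.transpose_def)
      then show ?thesis
        using st by (auto simp: inversions_def)
    qed
  qed
  show "(Hilbert_Choice.inv \<tau> k, Hilbert_Choice.inv \<tau> (Suc k)) \<notin> inversions m \<tau>"
    by (auto simp: inversions_def inv)
qed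

text \<open>Without descents no point moves down. If \<open>p\<close> moved up, the larger point
  \<open>\<sigma> p\<close> would already be known to be fixed, by induction downwards from
  \<open>m\<close>, contradicting injectivity.\<close>

lemma strict_mono_permutes_eq_id:
  assumes \<sigma>: "\<sigma> permutes {..<m::nat}" and mono: "\<And>k. Suc k < m \<Longrightarrow> \<sigma> k < \<sigma> (Suc k)"
  shows "\<sigma> = id"
proof -
  have ge: "p < m \<Longrightarrow> p \<le> \<sigma> p" for p
  proof (induction p)
    case (Suc p)
    then show ?case
      using mono[of p] by simp
  qed simp
  have "p < m \<Longrightarrow> \<sigma> p = p" for p
  proof (induction "m - p" arbitrary: p rule: less_induct)
    case less
    show ?case
    proof (rule ccontr)
      assume "\<sigma> p \<noteq> p"
      then have "p < \<sigma> p"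
        using ge[of p] less.prems by simp
      moreover have lt: "\<sigma> p < m"
        using permutes_in_image[OF \<sigma>, of p] less.prems by simp
      ultimately have "\<sigma> (\<sigma> p) = \<sigma> p"
        using less.hyps[of "\<sigma> p"] by simp
      then show False
        using permutes_inj[OF \<sigma>] \<open>p < \<sigma> p\<close> by (metis injD less_irrefl)
    qed
  qed
  then show ?thesis
    using permutes_not_in[OF \<sigma>] by (metis eq_id_iff lessThan_iff)
qed

lemma expresses_permutes: "expresses m \<sigma> ks \<Longrightarrow> \<sigma> permutes {..<m}"
proof (induction ks arbitrary: \<sigma>)
  case Nil
  then have "\<sigma> = id"
    by (simp add: expresses_def)
  then show ?case
    using permutes_id by blast
next
  case (Cons k ks)
  then have "foldr (\<lambda>k \<tau>. Transposition.transpose k (Suc k) \<circ> \<tau>) ks id permutes {..<m}" and k: "Suc k < m"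
    by (auto simp: expresses_def)
  moreover have "Transposition.transpose k (Suc k) permutes {..<m}"
    using k by (intro permutes_swap_id) auto
  ultimately show ?case
    using Cons.prems permutes_compose by (auto simp: expresses_def)
qed

lemma expresses_Cons:
  "expresses m \<sigma> (k # ks) \<longleftrightarrow>
    Suc k < m \<and> (\<exists>\<tau>. expresses m \<tau> ks \<and> \<sigma> = Transposition.transpose k (Suc k) \<circ> \<tau>)"
  by (auto simp: expresses_def)

text \<open>Each simple transposition creates at most one inversion, which bounds the length of an
  expression from below.\<close>

lemma card_inversions_le_length: "expresses m \<sigma> ks \<Longrightarrow> card (inversions m \<sigma>) \<le> length ks"
proof (induction ks arbitrary: \<sigma>)
  case Nil
  then have "\<sigma> = id"
    by (simp add: expresses_def)
  then show ?case
    by (metis inversions_id card.empty le0)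
next
  case (Cons k ks)
  then obtain \<tau> where \<tau>: "expresses m \<tau> ks" "\<sigma> = Transposition.transpose k (Suc k) \<circ> \<tau>"
    by (auto simp: expresses_Cons)
  have "card (inversions m \<sigma>) \<le> card (insert (Hilbert_Choice.inv \<tau> k, Hilbert_Choice.inv \<tau> (Suc k)) (inversions m \<tau>))"
    using inversions_transpose_comp[OF expresses_permutes[OF \<tau>(1)]] unfolding \<tau>(2)
    by (intro card_mono) auto
  also have "\<dots> \<le> Suc (card (inversions m \<tau>))"
    by (simp add: card_insert_le_m1 card_insert_if)
  finally show ?case
    using Cons.IH[OF \<tau>(1)] by simp
qed

text \<open>Bubble sort: a permutation other than the identity loses exactly one inversion under a
  suitable simple transposition, so the lower bound on the length is attained.\<close>

lemma ex_expresses_length_inversions: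
  assumes "\<sigma> permutes {..<m}"
  shows "\<exists>ks. expresses m \<sigma> ks \<and> length ks = card (inversions m \<sigma>)"
  using assms
proof (induction "card (inversions m \<sigma>)" arbitrary: \<sigma> rule: less_induct)
  case less
  note inv_perm = permutes_inv[OF less.prems]
  show ?case
  proof (cases "\<sigma> = id")
    case True
    then show ?thesis
      by (intro exI[of _ "[]"]) (simp add: expresses_def flip: id_def)
  next
    case False
    then have "Hilbert_Choice.inv \<sigma> \<noteq> id"
      using permutes_inv_o(1)[OF less.prems] by auto
    \<comment> \<open>The transposition is composed on the left and acts on values, so the descent
      is sought in the inverse permutation.\<close>
    then obtain k where k: "Suc k < m" "\<not> Hilbert_Choice.inv \<sigma> k < Hilbert_Choice.inv \<sigma> (Suc k)"
      using strict_mono_permutes_eq_id[OF inv_perm] by blast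
    moreover have "Hilbert_Choice.inv \<sigma> k \<noteq> Hilbert_Choice.inv \<sigma> (Suc k)"
      using permutes_inj[OF inv_perm] by (metis injD n_not_Suc_n)
    ultimately have gt: "Hilbert_Choice.inv \<sigma> (Suc k) < Hilbert_Choice.inv \<sigma> k"
      by simp
    let ?s = "Transposition.transpose k (Suc k)"
    define \<tau> where "\<tau> = ?s \<circ> \<sigma>"
    have \<sigma>: "\<sigma> = ?s \<circ> \<tau>"
      by (auto simp: \<tau>_def fun_eq_iff)
    have s: "?s permutes {..<m}"
      using k by (intro permutes_swap_id) auto
    have \<tau>: "\<tau> permutes {..<m}"
      unfolding \<tau>_def using less.prems s by (rule permutes_compose)
    have "Hilbert_Choice.inv \<tau> = Hilbert_Choice.inv \<sigma> \<circ> ?s"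
      unfolding \<tau>_def using permutes_bij[OF less.prems] permutes_bij[OF s]
      by (simp add: o_inv_distrib)
    then have "Hilbert_Choice.inv \<tau> k < Hilbert_Choice.inv \<tau> (Suc k)"
      using gt by simp
    from inversions_transpose_comp_less[OF \<tau> k(1) this]
    have card: "card (inversions m \<sigma>) = Suc (card (inversions m \<tau>))"
      unfolding \<sigma>[symmetric] by simp
    then obtain ks where "expresses m \<tau> ks" "length ks = card (inversions m \<tau>)"
      using less.hyps[OF _ \<tau>] by auto
    then show ?thesis
      using card k(1) \<sigma> by (intro exI[of _ "k # ks"]) (auto simp: expresses_Cons)
  qed
qed

text \<open>Minimal length thus means one transposition per inversion; nothing more has to be known
  about the expression chosen in \<open>braid_lift\<close>.\<close>

lemma reduced_expression_SOME:
  assumes "\<sigma> permutes {..<m}"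
  shows "expresses m \<sigma> (SOME ks. reduced_expression m \<sigma> ks)"
    and "length (SOME ks. reduced_expression m \<sigma> ks) = card (inversions m \<sigma>)"
proof -
  obtain ks where ks: "expresses m \<sigma> ks" "length ks = card (inversions m \<sigma>)"
    using ex_expresses_length_inversions[OF assms] by blast
  then have "reduced_expression m \<sigma> ks"
    using card_inversions_le_length by (auto simp: reduced_expression_def is_arg_min_linorder)
  then have red: "reduced_expression m \<sigma> (SOME ks. reduced_expression m \<sigma> ks)"
    by (rule someI)
  then show "expresses m \<sigma> (SOME ks. reduced_expression m \<sigma> ks)"
    by (simp add: reduced_expression_def is_arg_min_linorder)
  then show "length (SOME ks. reduced_expression m \<sigma> ks) = card (inversions m \<sigma>)"
    using red ks card_inversions_le_length
    by (intro antisym) (fastforce simp: reduced_expression_def is_arg_min_linorder)+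
qed

section \<open>The quantum symmetrizers on words\<close>

lemma swap_word_eq:
  assumes "Suc k < length w"
  shows "take k w @ [w ! Suc k, w ! k] @ drop (k + 2) w
      = map (\<lambda>p. w ! Transposition.transpose k (Suc k) p) [0..<length w]"
proof (rule nth_equalityI)
  fix p
  assume "p < length (take k w @ [w ! Suc k, w ! k] @ drop (k + 2) w)"
  then have p: "p < length w"
    using assms by simp
  consider "p < k" | "p = k" | "p = Suc k" | d where "p = Suc (Suc (k + d))"
    by (metis add_Suc less_iff_Suc_add less_antisym linorder_neqE_nat not_less_eq)
  then show "(take k w @ [w ! Suc k, w ! k] @ drop (k + 2) w) ! p
      = map (\<lambda>p. w ! Transposition.transpose k (Suc k) p) [0..<length w] ! p"
  proof cases
    case 1
    then show ?thesis
      using p by (simp add: nth_append transpose_apply_other)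
  next
    case 2
    then show ?thesis
      using assms by (simp add: nth_append)
  next
    case 3
    then show ?thesis
      using assms by (simp add: nth_append)
  next
    case 4
    then show ?thesis
      using p by (simp add: nth_append transpose_apply_other)
  qed
qed (use assms in simp)

lemma braiding_at_eq:
  "braiding_at q k v = (\<Sum>w\<in>Poly_Mapping.keys v.
     Poly_Mapping.single (take k w @ [w ! Suc k, w ! k] @ drop (k + 2) w)
       (Poly_Mapping.lookup v w * q (w ! k) (w ! Suc k)))"
  unfolding braiding_at_def linear_extension_def
  by (simp add: tensor_scalar_def tensor_word_def braiding_def mult_single plus_list_def)

lemma braiding_at_tensor_power:
  assumes "v \<in> tensor_power m" "Suc k < m"
  shows "braiding_at q k v \<in> tensor_power m"
proof -
  have "length w' = m" if "Poly_Mapping.lookup (braiding_at q k v) w' \<noteq> 0" for w'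
  proof -
    from that obtain w where w: "w \<in> Poly_Mapping.keys v"
      "take k w @ [w ! Suc k, w ! k] @ drop (k + 2) w = w'"
      unfolding braiding_at_eq lookup_sum lookup_single
      by (elim sum.not_neutral_contains_not_neutral) (auto simp: when_def split: if_splits)
    then have "length w = m"
      using assms by (auto simp: tensor_power_def)
    then show ?thesis
      using assms w(2) by auto
  qed
  then show ?thesis
    by (auto simp: tensor_power_def in_keys_iff)
qed

text \<open>The word \<open>w'\<close> arises only from the word in which its letters at
  \<open>k\<close> and \<open>Suc k\<close> are exchanged back; hence the reversed order of the
  arguments of \<open>q\<close>.\<close>

lemma lookup_braiding_at:
  assumes v: "v \<in> tensor_power m" and k: "Suc k < m" and w': "length w' = m"
  shows "Poly_Mapping.lookup (braiding_at q k v) w' = q (w' ! Suc k) (w' ! k) *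
    Poly_Mapping.lookup v (map (\<lambda>p. w' ! Transposition.transpose k (Suc k) p) [0..<m])"
proof -
  let ?S = "\<lambda>w. map (\<lambda>p. w ! Transposition.transpose k (Suc k) p) [0..<m]"
  have less: "Transposition.transpose k (Suc k) p < m" if "p < m" for p
    using k that by (auto simp: Transposition.transpose_def)
  have invol: "?S (?S w) = w" if "length w = m" for w
    using that less by (intro nth_equalityI) auto
  have len: "length w = m" if "w \<in> Poly_Mapping.keys v" for w
    using that v by (auto simp: tensor_power_def)
  have "Poly_Mapping.lookup (braiding_at q k v) w' = (\<Sum>w\<in>Poly_Mapping.keys v.
      if w = ?S w' then q (w' ! Suc k) (w' ! k) * Poly_Mapping.lookup v (?S w') else 0)"
    unfolding braiding_at_eq lookup_sum lookup_single
  proof (rule sum.cong)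
    fix w
    assume "w \<in> Poly_Mapping.keys v"
    note len = len[OF this]
    have "take k w @ [w ! Suc k, w ! k] @ drop (k + 2) w = ?S w"
      using swap_word_eq[of k w] len k by simp
    moreover have "?S w = w' \<longleftrightarrow> w = ?S w'"
      using invol[OF len] invol[OF w'] by metis
    moreover have "?S w' ! k = w' ! Suc k" "?S w' ! Suc k = w' ! k"
      using k by auto
    ultimately show "(Poly_Mapping.lookup v w * q (w ! k) (w ! Suc k)
        when take k w @ [w ! Suc k, w ! k] @ drop (k + 2) w = w') =
      (if w = ?S w' then q (w' ! Suc k) (w' ! k) * Poly_Mapping.lookup v (?S w') else 0)"
      by (simp add: when_def)
  qed simp
  also have "\<dots> = q (w' ! Suc k) (w' ! k) * Poly_Mapping.lookup v (?S w')"
    by (simp add: in_keys_iff)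
  finally show ?thesis .
qed

text \<open>The resulting formula mentions \<open>\<sigma>\<close> but not \<open>ks\<close>, so
  independence of the reduced expression comes out without invoking the braid relations.\<close>

lemma lookup_foldr_braiding_at:
  assumes "expresses m \<sigma> ks" "length ks = card (inversions m \<sigma>)" "v \<in> tensor_power m"
  shows "foldr (\<lambda>k f. braiding_at q k \<circ> f) ks id v \<in> tensor_power m \<and>
    (\<forall>w'. length w' = m \<longrightarrow>
      Poly_Mapping.lookup (foldr (\<lambda>k f. braiding_at q k \<circ> f) ks id v) w' =
      (\<Prod>(s, t)\<in>inversions m \<sigma>. q (w' ! \<sigma> s) (w' ! \<sigma> t)) *
      Poly_Mapping.lookup v (map (\<lambda>p. w' ! \<sigma> p) [0..<m]))"
  using assms(1,2)
proof (induction ks arbitrary: \<sigma>)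
  case Nil
  from Nil(1) have "\<sigma> = id"
    by (simp add: expresses_def)
  show ?case
  proof (intro conjI allI impI)
    fix w' :: "'a list"
    assume "length w' = m"
    then have "map (\<lambda>p. w' ! \<sigma> p) [0..<m] = w'"
      unfolding \<open>\<sigma> = id\<close> by (intro nth_equalityI) simp_all
    then show "Poly_Mapping.lookup (foldr (\<lambda>k f. braiding_at q k \<circ> f) [] id v) w' =
        (\<Prod>(s, t)\<in>inversions m \<sigma>. q (w' ! \<sigma> s) (w' ! \<sigma> t)) *
        Poly_Mapping.lookup v (map (\<lambda>p. w' ! \<sigma> p) [0..<m])"
      unfolding \<open>\<sigma> = id\<close> inversions_id by simp
  qed (use assms(3) in simp)
next
  case (Cons k ks)
  let ?s = "Transposition.transpose k (Suc k)"
  obtain \<tau> where \<tau>: "expresses m \<tau> ks" and \<sigma>: "\<sigma> = ?s \<circ> \<tau>" and k: "Suc k < m"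
    using Cons.prems(1) by (auto simp: expresses_Cons)
  note perm = expresses_permutes[OF \<tau>]
  have le: "card (inversions m \<tau>) \<le> length ks"
    by (rule card_inversions_le_length[OF \<tau>])
  \<comment> \<open>Otherwise passing from \<open>\<tau>\<close> to \<open>\<sigma>\<close> would
    add no inversion, and \<open>k # ks\<close> would be longer than the number of inversions of
    \<open>\<sigma>\<close>.\<close>
  have less: "Hilbert_Choice.inv \<tau> k < Hilbert_Choice.inv \<tau> (Suc k)"
  proof (rule ccontr)
    assume "\<not> ?thesis"
    then have "(Hilbert_Choice.inv \<tau> k, Hilbert_Choice.inv \<tau> (Suc k)) \<notin> inversions m \<sigma>"
      by (auto simp: inversions_def)
    then have "inversions m \<sigma> \<subseteq> inversions m \<tau>"
      using inversions_transpose_comp[OF perm, of k] unfolding \<sigma> by blast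
    then have "card (inversions m \<sigma>) \<le> card (inversions m \<tau>)"
      by (intro card_mono) auto
    then show False
      using le Cons.prems(2) by simp
  qed
  note insert = inversions_transpose_comp_less[OF perm k less, folded \<sigma>]
  have card: "length ks = card (inversions m \<tau>)"
    using insert Cons.prems(2) by simp
  define v' where "v' = foldr (\<lambda>k f. braiding_at q k \<circ> f) ks id v"
  note v'_IH = Cons.IH[OF \<tau> card, folded v'_def]
  have v': "v' \<in> tensor_power m"
    by (rule conjunct1[OF v'_IH])
  note IH = conjunct2[OF v'_IH, rule_format]
  have \<tau>_less: "\<tau> p < m" if "p < m" for p
    using permutes_in_image[OF perm, of p] that by simp
  have lookup: "Poly_Mapping.lookup (braiding_at q k v') w' =
      (\<Prod>(s, t)\<in>inversions m \<sigma>. q (w' ! \<sigma> s) (w' ! \<sigma> t)) *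
      Poly_Mapping.lookup v (map (\<lambda>p. w' ! \<sigma> p) [0..<m])" if w': "length w' = m" for w'
  proof -
    \<comment> \<open>\<open>w\<close> undoes the outermost braiding, so that reading
      \<open>w\<close> along \<open>\<tau>\<close> is reading \<open>w'\<close> along
      \<open>\<sigma>\<close>.\<close>
    define w where "w = map (\<lambda>p. w' ! ?s p) [0..<m]"
    have w: "w ! \<tau> p = w' ! \<sigma> p" if "p < m" for p
      using \<tau>_less[OF that] by (simp add: w_def \<sigma>)
    have "(\<Prod>(s, t)\<in>inversions m \<tau>. q (w ! \<tau> s) (w ! \<tau> t))
        = (\<Prod>(s, t)\<in>inversions m \<tau>. q (w' ! \<sigma> s) (w' ! \<sigma> t))"
      by (intro prod.cong) (auto simp: inversions_def w)
    moreover have "map (\<lambda>p. w ! \<tau> p) [0..<m] = map (\<lambda>p. w' ! \<sigma> p) [0..<m]"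
      by (simp add: w)
    moreover have "length w = m"
      by (simp add: w_def)
    ultimately have v'_w: "Poly_Mapping.lookup v' w =
        (\<Prod>(s, t)\<in>inversions m \<tau>. q (w' ! \<sigma> s) (w' ! \<sigma> t)) *
        Poly_Mapping.lookup v (map (\<lambda>p. w' ! \<sigma> p) [0..<m])"
      using IH[of w] by metis
    have \<sigma>_inv: "\<sigma> (Hilbert_Choice.inv \<tau> k) = Suc k" "\<sigma> (Hilbert_Choice.inv \<tau> (Suc k)) = k"
      by (simp_all add: \<sigma> permutes_inverses(1)[OF perm])
    have "(\<Prod>(s, t)\<in>inversions m \<sigma>. q (w' ! \<sigma> s) (w' ! \<sigma> t)) = q (w' ! Suc k) (w' ! k) *
        (\<Prod>(s, t)\<in>inversions m \<tau>. q (w' ! \<sigma> s) (w' ! \<sigma> t))"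
      unfolding insert(1) prod.insert[OF finite_inversions insert(2)] prod.case \<sigma>_inv ..
    moreover have "Poly_Mapping.lookup (braiding_at q k v') w' =
        q (w' ! Suc k) (w' ! k) * Poly_Mapping.lookup v' w"
      unfolding w_def by (rule lookup_braiding_at[OF v' k w'])
    ultimately show ?thesis
      by (simp only: v'_w mult.assoc)
  qed
  have foldr: "foldr (\<lambda>k f. braiding_at q k \<circ> f) (k # ks) id v = braiding_at q k v'"
    by (simp only: v'_def foldr.simps o_apply)
  show ?case
    unfolding foldr by (intro conjI allI impI braiding_at_tensor_power[OF v' k] lookup)
qed

lemma
  assumes "\<sigma> permutes {..<m}" "v \<in> tensor_power m"
  shows braid_lift_tensor_power: "braid_lift q m \<sigma> v \<in> tensor_power m"
    and lookup_braid_lift: "length w = m \<Longrightarrow> Poly_Mapping.lookup (braid_lift q m \<sigma> v) w =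
      braid_weight q (nth w) (map \<sigma> [0..<m]) *
      Poly_Mapping.lookup v (map (nth w) (map \<sigma> [0..<m]))"
proof -
  note fold = lookup_foldr_braiding_at[OF reduced_expression_SOME[OF assms(1)] assms(2), of q]
  show "braid_lift q m \<sigma> v \<in> tensor_power m"
    unfolding braid_lift_def by (rule conjunct1[OF fold])
  assume w: "length w = m"
  have lookup: "Poly_Mapping.lookup (braid_lift q m \<sigma> v) w =
      (\<Prod>(s, t)\<in>inversions m \<sigma>. q (w ! \<sigma> s) (w ! \<sigma> t)) *
      Poly_Mapping.lookup v (map (\<lambda>p. w ! \<sigma> p) [0..<m])"
    unfolding braid_lift_def by (rule conjunct2[OF fold, rule_format, OF w])
  have "distinct (map \<sigma> [0..<m])"
    using permutes_inj[OF assms(1)] by (simp add: distinct_map inj_on_def inj_def)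
  moreover have "inversions m (nth (map \<sigma> [0..<m])) = inversions m \<sigma>"
    by (auto simp: inversions_def)
  moreover have "(\<Prod>(s, t)\<in>inversions m \<sigma>.
        q (w ! (map \<sigma> [0..<m] ! s)) (w ! (map \<sigma> [0..<m] ! t)))
      = (\<Prod>(s, t)\<in>inversions m \<sigma>. q (w ! \<sigma> s) (w ! \<sigma> t))"
    by (intro prod.cong) (auto simp: inversions_def)
  ultimately show "Poly_Mapping.lookup (braid_lift q m \<sigma> v) w =
      braid_weight q (nth w) (map \<sigma> [0..<m]) *
      Poly_Mapping.lookup v (map (nth w) (map \<sigma> [0..<m]))"
    by (simp add: lookup braid_weight_eq_prod_inversions comp_def)
qed

text \<open>One-line notation turns sums over permutations into sums over orderings, which can be
  split at either end.\<close>

lemma bij_betw_permutes_permutations_of_set: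
  "bij_betw (\<lambda>\<sigma>. map \<sigma> [0..<m]) {\<sigma>. \<sigma> permutes {..<m}} (permutations_of_set {..<m})"
proof (rule bij_betwI')
  fix \<sigma> \<tau>
  assume "\<sigma> \<in> {\<sigma>. \<sigma> permutes {..<m}}" "\<tau> \<in> {\<sigma>. \<sigma> permutes {..<m}}"
  then show "map \<sigma> [0..<m] = map \<tau> [0..<m] \<longleftrightarrow> \<sigma> = \<tau>"
    by (auto simp: fun_eq_iff permutes_def map_eq_conv)
next
  fix \<sigma>
  assume "\<sigma> \<in> {\<sigma>. \<sigma> permutes {..<m}}"
  then show "map \<sigma> [0..<m] \<in> permutations_of_set {..<m}"
    using permutes_image[of \<sigma> "{..<m}"] permutes_inj[of \<sigma> "{..<m}"]
    by (auto simp: permutations_of_set_def distinct_map lessThan_atLeast0 inj_on_def inj_def)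
next
  fix ps
  assume "ps \<in> permutations_of_set {..<m}"
  then have ps: "set ps = {..<m}" "distinct ps"
    by (auto simp: permutations_of_set_def)
  then have m: "length ps = m"
    using distinct_card[OF ps(2)] by simp
  \<comment> \<open>\<open>permutes\<close> demands the identity outside
    \<open>{..<m}\<close>.\<close>
  define \<sigma> where "\<sigma> p = (if p < m then ps ! p else p)" for p
  have "bij_betw (nth ps) {..<m} {..<m}"
    by (rule bij_betw_nth[OF ps(2)]) (simp_all add: m ps(1))
  moreover have "bij_betw \<sigma> {..<m} {..<m} \<longleftrightarrow> bij_betw (nth ps) {..<m} {..<m}"
    by (rule bij_betw_cong) (simp add: \<sigma>_def)
  ultimately have "bij_betw \<sigma> {..<m} {..<m}"
    by (rule iffD2[rotated])
  then have "\<sigma> permutes {..<m}"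
    by (rule bij_imp_permutes) (simp add: \<sigma>_def)
  moreover have "ps = map \<sigma> [0..<m]"
    by (rule nth_equalityI) (simp_all add: m \<sigma>_def)
  ultimately show "\<exists>\<sigma>\<in>{\<sigma>. \<sigma> permutes {..<m}}. ps = map \<sigma> [0..<m]"
    by blast
qed

text \<open>For \<open>A = {..<m}\<close> this is a coefficient of the quantum symmetrizer in degree
  \<open>m\<close>. Allowing any finite \<open>A\<close> keeps the family of functionals stable
  under removing a position.\<close>

definition symmetrizer_value ::
  "('i \<Rightarrow> 'i \<Rightarrow> 'a::field) \<Rightarrow> nat set \<Rightarrow> (nat \<Rightarrow> 'i) \<Rightarrow> ('i, 'a) tensor_algebra \<Rightarrow> 'a" where
  "symmetrizer_value q A w u =
     (\<Sum>ps\<in>permutations_of_set A. braid_weight q w ps * Poly_Mapping.lookup u (map w ps))"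

lemma lookup_quantum_symmetrizer:
  assumes "u \<in> tensor_power m"
  shows "Poly_Mapping.lookup (quantum_symmetrizer q m u) w =
    (if length w = m then symmetrizer_value q {..<m} (nth w) u else 0)"
proof (cases "length w = m")
  case True
  have "symmetrizer_value q {..<m} (nth w) u = (\<Sum>\<sigma> | \<sigma> permutes {..<m}.
      braid_weight q (nth w) (map \<sigma> [0..<m]) * Poly_Mapping.lookup u (map (nth w) (map \<sigma> [0..<m])))"
    unfolding symmetrizer_value_def
    by (rule sum.reindex_bij_betw[OF bij_betw_permutes_permutations_of_set, symmetric])
  then show ?thesis
    using True assms by (simp add: quantum_symmetrizer_def lookup_sum lookup_braid_lift del: map_map)
next
  case False
  then have "Poly_Mapping.lookup (braid_lift q m \<sigma> u) w = 0" if "\<sigma> permutes {..<m}" for \<sigma>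
    using braid_lift_tensor_power[OF that assms, of q] by (auto simp: tensor_power_def in_keys_iff)
  then show ?thesis
    using False by (simp add: quantum_symmetrizer_def lookup_sum)
qed

section \<open>The defining ideal\<close>

lemma single_mult_eq:
  fixes u :: "('i, 'a::field) tensor_algebra"
  shows "Poly_Mapping.single a c * u
    = (\<Sum>v\<in>Poly_Mapping.keys u. Poly_Mapping.single (a @ v) (c * Poly_Mapping.lookup u v))"
proof -
  have "Poly_Mapping.single a c * linear_extension tensor_word u
      = (\<Sum>v\<in>Poly_Mapping.keys u. Poly_Mapping.single (a @ v) (c * Poly_Mapping.lookup u v))"
    unfolding linear_extension_def sum_distrib_left
    by (simp add: tensor_scalar_def tensor_word_def mult_single plus_list_def)
  then show ?thesis
    by (simp only: linear_extension_word)
qed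

lemma mult_single_eq:
  fixes u :: "('i, 'a::field) tensor_algebra"
  shows "u * Poly_Mapping.single a c
    = (\<Sum>v\<in>Poly_Mapping.keys u. Poly_Mapping.single (v @ a) (Poly_Mapping.lookup u v * c))"
proof -
  have "linear_extension tensor_word u * Poly_Mapping.single a c
      = (\<Sum>v\<in>Poly_Mapping.keys u. Poly_Mapping.single (v @ a) (Poly_Mapping.lookup u v * c))"
    unfolding linear_extension_def sum_distrib_right
    by (simp add: tensor_scalar_def tensor_word_def mult_single plus_list_def)
  then show ?thesis
    by (simp only: linear_extension_word)
qed

lemma lookup_tensor_scalar_mult [simp]:
  "Poly_Mapping.lookup (tensor_scalar c * u) w = c * Poly_Mapping.lookup u w"
  unfolding tensor_scalar_def single_mult_eq
  by (simp add: lookup_sum lookup_single when_def in_keys_iff)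

lemma lookup_letter_mult_Cons:
  "Poly_Mapping.lookup (tensor_word [i] * u) (j # w) = (if j = i then Poly_Mapping.lookup u w else 0)"
  unfolding tensor_word_def single_mult_eq
  by (auto simp: lookup_sum lookup_single when_def in_keys_iff)

lemma lookup_letter_mult_Nil [simp]: "Poly_Mapping.lookup (tensor_word [i] * u) [] = 0"
  unfolding tensor_word_def single_mult_eq
  by (simp add: lookup_sum lookup_single when_def)

lemma lookup_mult_letter_snoc:
  "Poly_Mapping.lookup (u * tensor_word [i]) (w @ [j]) = (if j = i then Poly_Mapping.lookup u w else 0)"
  unfolding tensor_word_def mult_single_eq
  by (auto simp: lookup_sum lookup_single when_def in_keys_iff)

lemma lookup_mult_letter_Nil [simp]: "Poly_Mapping.lookup (u * tensor_word [i]) [] = 0"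
  unfolding tensor_word_def mult_single_eq
  by (simp add: lookup_sum lookup_single when_def)

lemma tensor_word_append: "tensor_word (v @ w) = tensor_word v * tensor_word w"
  by (simp add: tensor_word_def mult_single plus_list_def)

lemma tensor_word_Nil [simp]: "tensor_word [] = 1"
  by (simp add: tensor_word_def zero_list_def flip: single_one)

section \<open>Splitting orderings of a set at the first or last position\<close>

lemma sum_permutations_of_set_Cons:
  fixes f :: "'b list \<Rightarrow> 'c::comm_monoid_add"
  assumes "finite A" "A \<noteq> {}"
  shows "(\<Sum>ps\<in>permutations_of_set A. f ps)
    = (\<Sum>p\<in>A. \<Sum>ps\<in>permutations_of_set (A - {p}). f (p # ps))"
  unfolding permutations_of_set_nonempty[OF assms(2)] using assms(1)
  by (subst sum.UNION_disjoint) (auto simp: sum.reindex inj_on_def)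

lemma sum_permutations_of_set_rev:
  "(\<Sum>ps\<in>permutations_of_set A. f (rev ps)) = (\<Sum>ps\<in>permutations_of_set A. f ps)"
  by (rule sum.reindex_bij_betw) (simp add: bij_betw_def)

lemma sum_permutations_of_set_snoc:
  fixes f :: "'b list \<Rightarrow> 'c::comm_monoid_add"
  assumes "finite A" "A \<noteq> {}"
  shows "(\<Sum>ps\<in>permutations_of_set A. f ps)
    = (\<Sum>p\<in>A. \<Sum>ps\<in>permutations_of_set (A - {p}). f (ps @ [p]))"
proof -
  have "(\<Sum>ps\<in>permutations_of_set A. f ps)
      = (\<Sum>p\<in>A. \<Sum>ps\<in>permutations_of_set (A - {p}). f (rev (p # ps)))"
    by (subst sum_permutations_of_set_rev[symmetric]) (rule sum_permutations_of_set_Cons[OF assms])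
  also have "\<dots> = (\<Sum>p\<in>A. \<Sum>ps\<in>permutations_of_set (A - {p}). f (ps @ [p]))"
    by (simp add: sum_permutations_of_set_rev[where f = "\<lambda>ps. f (ps @ [_])"])
  finally show ?thesis .
qed

text \<open>Grouping the orderings by their first position \<open>p\<close> leaves orderings of
  \<open>A - {p}\<close>. The functionals of the product are thus combinations of functionals of
  \<open>u\<close>, so their vanishing passes to left multiples.\<close>

lemma symmetrizer_value_letter_mult:
  assumes "finite A"
  shows "symmetrizer_value q A w (tensor_word [i] * u) = (\<Sum>p\<in>A.
    if w p = i then (\<Prod>r | r \<in> A - {p} \<and> r < p. q (w p) (w r)) * symmetrizer_value q (A - {p}) w u
    else 0)"
proof (cases "A = {}")
  case True
  then show ?thesis by (simp add: symmetrizer_value_def)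
next
  case False
  then show ?thesis
    unfolding symmetrizer_value_def sum_permutations_of_set_Cons[OF assms False]
    by (intro sum.cong refl)
      (auto simp: lookup_letter_mult_Cons sum_distrib_left mult.assoc permutations_of_set_def intro!: sum.cong)
qed

text \<open>The mirror image: grouping by the last position handles right multiples.\<close>

lemma symmetrizer_value_mult_letter:
  assumes "finite A"
  shows "symmetrizer_value q A w (u * tensor_word [i]) = (\<Sum>p\<in>A.
    if w p = i then symmetrizer_value q (A - {p}) w u * (\<Prod>r | r \<in> A - {p} \<and> p < r. q (w r) (w p))
    else 0)"
proof (cases "A = {}")
  case True
  then show ?thesis by (simp add: symmetrizer_value_def)
next
  case False
  show ?thesis
    unfolding symmetrizer_value_def sum_permutations_of_set_snoc[OF assms False]
  proof (intro sum.cong refl)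
    fix p
    have "braid_weight q w (ps @ [p]) = braid_weight q w ps * (\<Prod>r | r \<in> A - {p} \<and> p < r. q (w r) (w p))"
      if "ps \<in> permutations_of_set (A - {p})" for ps
      using braid_weight_snoc[of ps p q w] permutations_of_setD[OF that] by simp
    then show "(\<Sum>ps\<in>permutations_of_set (A - {p}). braid_weight q w (ps @ [p]) *
        Poly_Mapping.lookup (u * tensor_word [i]) (map w (ps @ [p]))) =
      (if w p = i then (\<Sum>ps\<in>permutations_of_set (A - {p}). braid_weight q w ps *
        Poly_Mapping.lookup u (map w ps)) * (\<Prod>r | r \<in> A - {p} \<and> p < r. q (w r) (w p)) else 0)"
      by (simp add: lookup_mult_letter_snoc sum_distrib_right mult_ac)
  qed
qed

section \<open>Linearity of the functionals and their invariance under relabelling\<close>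

lemma symmetrizer_value_0 [simp]: "symmetrizer_value q A w 0 = 0"
  by (simp add: symmetrizer_value_def)

lemma symmetrizer_value_add:
  "symmetrizer_value q A w (u + v) = symmetrizer_value q A w u + symmetrizer_value q A w v"
  by (simp add: symmetrizer_value_def lookup_add distrib_left sum.distrib)

lemma symmetrizer_value_uminus: "symmetrizer_value q A w (- u) = - symmetrizer_value q A w u"
  by (simp add: symmetrizer_value_def sum_negf)

lemma symmetrizer_value_sum:
  "symmetrizer_value q A w (\<Sum>x\<in>X. f x) = (\<Sum>x\<in>X. symmetrizer_value q A w (f x))"
  by (induction X rule: infinite_finite_induct) (simp_all add: symmetrizer_value_add)

lemma symmetrizer_value_scalar:
  "symmetrizer_value q A w (tensor_scalar c * u) = c * symmetrizer_value q A w u"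
  by (simp add: symmetrizer_value_def sum_distrib_left ac_simps)

lemma symmetrizer_value_cong:
  assumes "\<And>v. length v = card A \<Longrightarrow> Poly_Mapping.lookup u v = Poly_Mapping.lookup u' v"
  shows "symmetrizer_value q A w u = symmetrizer_value q A w u'"
  unfolding symmetrizer_value_def
  by (intro sum.cong refl) (simp add: assms length_finite_permutations_of_set)

lemma symmetrizer_value_image:
  assumes "strict_mono_on A e"
  shows "symmetrizer_value q (e ` A) w u = symmetrizer_value q A (w \<circ> e) u"
proof -
  have inj: "inj_on e A"
    using assms by (rule strict_mono_on_imp_inj_on)
  have "inj_on (map e) (permutations_of_set A)"
    by (rule inj_on_subset[OF inj_on_mapI[of e "{ps. set ps \<subseteq> A}"]])
      (auto simp: permutations_of_set_def intro: inj_on_subset[OF inj])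
  moreover have "braid_weight q w (map e ps) = braid_weight q (w \<circ> e) ps"
    if "ps \<in> permutations_of_set A" for ps
    using that assms braid_weight_map permutations_of_setD(1) by metis
  ultimately show ?thesis
    unfolding symmetrizer_value_def permutations_of_set_image_inj[OF inj]
    by (simp add: sum.reindex)
qed

lemma braid_weight_cong: "(\<And>p. p \<in> set ps \<Longrightarrow> w p = w' p) \<Longrightarrow> braid_weight q w ps = braid_weight q w' ps"
  by (induction ps) (auto intro!: prod.cong)

lemma symmetrizer_value_index_cong:
  assumes "\<And>p. p \<in> A \<Longrightarrow> w p = w' p"
  shows "symmetrizer_value q A w u = symmetrizer_value q A w' u"
proof -
  have "braid_weight q w ps = braid_weight q w' ps" "map w ps = map w' ps"
    if "ps \<in> permutations_of_set A" for ps
    using that assms by (auto simp: permutations_of_set_def intro!: braid_weight_cong)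
  then show ?thesis
    unfolding symmetrizer_value_def by (intro sum.cong refl) metis
qed

text \<open>The kernel itself tests only \<open>A = {..<m}\<close>; the increasing enumeration
  \<open>e\<close> of a set of \<open>m\<close> positions transports this test to every such
  set.\<close>

lemma symmetrizer_kernel_iff:
  "u \<in> symmetrizer_kernel q m \<longleftrightarrow>
    u \<in> tensor_power m \<and> (\<forall>A w. finite A \<and> card A = m \<longrightarrow> symmetrizer_value q A w u = 0)"
proof (intro iffI conjI allI impI)
  assume u: "u \<in> symmetrizer_kernel q m"
  then show *: "u \<in> tensor_power m"
    by (simp add: symmetrizer_kernel_def)
  fix A :: "nat set" and w :: "nat \<Rightarrow> 'a"
  assume A: "finite A \<and> card A = m"
  define e where "e = nth (sorted_list_of_set A)"
  have len: "length (sorted_list_of_set A) = m"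
    using A by simp
  have "strict_mono_on {..<m} e"
    unfolding e_def strict_mono_on_def
    using len sorted_wrt_nth_less[OF strict_sorted_list_of_set[of A]] by simp
  moreover have "e ` {..<m} = set (sorted_list_of_set A)"
    using A by (auto simp: e_def set_conv_nth)
  then have "e ` {..<m} = A"
    using A by simp
  ultimately have "symmetrizer_value q A w u = symmetrizer_value q {..<m} (w \<circ> e) u"
    using symmetrizer_value_image by metis
  also have "\<dots> = symmetrizer_value q {..<m} (nth (map (w \<circ> e) [0..<m])) u"
    by (rule symmetrizer_value_index_cong) simp
  also have "\<dots> = Poly_Mapping.lookup (quantum_symmetrizer q m u) (map (w \<circ> e) [0..<m])"
    by (simp add: lookup_quantum_symmetrizer[OF *])
  finally show "symmetrizer_value q A w u = 0"
    using u by (simp add: symmetrizer_kernel_def)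
next
  assume u: "u \<in> tensor_power m \<and> (\<forall>A w. finite A \<and> card A = m \<longrightarrow> symmetrizer_value q A w u = 0)"
  then have "quantum_symmetrizer q m u = 0"
    by (intro poly_mapping_eqI) (simp add: lookup_quantum_symmetrizer)
  then show "u \<in> symmetrizer_kernel q m"
    using u by (simp add: symmetrizer_kernel_def)
qed

text \<open>A functional on \<open>A\<close> reads only words of length \<open>card A\<close>, so it
  sees a single tensor degree. This test by functionals replaces the sum of kernels in all closure
  proofs that follow.\<close>

lemma nichols_ideal_iff:
  "u \<in> nichols_ideal q \<longleftrightarrow> (\<forall>A w. finite A \<longrightarrow> symmetrizer_value q A w u = 0)"
proof (intro iffI allI impI)
  fix A :: "nat set" and w :: "nat \<Rightarrow> 'a"
  assume "u \<in> nichols_ideal q" and A: "finite A"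
  then obtain f N where u: "u = (\<Sum>m<N. f m)" and f: "\<And>m. f m \<in> symmetrizer_kernel q m"
    by (auto simp: nichols_ideal_def)
  have "symmetrizer_value q A w (f m) = 0" for m
  proof (cases "card A = m")
    case True
    then show ?thesis
      using f[of m] A by (auto simp: symmetrizer_kernel_iff)
  next
    case False
    have "Poly_Mapping.lookup (f m) v = 0" if "length v = card A" for v
    proof -
      have "v \<notin> Poly_Mapping.keys (f m)"
        using f[of m] False that by (auto simp: symmetrizer_kernel_iff tensor_power_def)
      then show ?thesis
        by (simp add: in_keys_iff)
    qed
    then have "symmetrizer_value q A w (f m) = symmetrizer_value q A w 0"
      by (intro symmetrizer_value_cong) simp
    then show ?thesis
      by simp
  qed
  then show "symmetrizer_value q A w u = 0"
    by (simp add: u symmetrizer_value_sum)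
next
  assume u: "\<forall>A w. finite A \<longrightarrow> symmetrizer_value q A w u = 0"
  \<comment> \<open>\<open>f m\<close> is the component of \<open>u\<close> in tensor degree
    \<open>m\<close>.\<close>
  define f where "f m = (\<Sum>v | v \<in> Poly_Mapping.keys u \<and> length v = m.
      Poly_Mapping.single v (Poly_Mapping.lookup u v))" for m
  have lookup_f: "Poly_Mapping.lookup (f m) v = (if length v = m then Poly_Mapping.lookup u v else 0)" for m v
    by (auto simp: f_def lookup_sum lookup_single when_def in_keys_iff)
  have "f m \<in> symmetrizer_kernel q m" for m
  proof -
    have "symmetrizer_value q A w (f m) = 0" if "finite A \<and> card A = m" for A w
      using u that symmetrizer_value_cong[of A "f m" u q w] by (simp add: lookup_f)
    moreover have "f m \<in> tensor_power m"
      by (auto simp: tensor_power_def in_keys_iff lookup_f split: if_splits)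
    ultimately show ?thesis
      by (simp add: symmetrizer_kernel_iff)
  qed
  \<comment> \<open>\<open>Suc\<close> lets the sum include the longest words. For
    \<open>u = 0\<close> the maximum is taken over the empty set, but then every component is zero
    and any bound will do.\<close>
  moreover have "u = (\<Sum>m<Suc (Max (length ` Poly_Mapping.keys u)). f m)"
  proof (rule poly_mapping_eqI)
    fix v
    have "Poly_Mapping.lookup u v = 0" if "\<not> length v \<le> Max (length ` Poly_Mapping.keys u)"
      using that by (metis Max_ge finite_imageI finite_keys image_eqI in_keys_iff)
    then show "Poly_Mapping.lookup u v
        = Poly_Mapping.lookup (\<Sum>m<Suc (Max (length ` Poly_Mapping.keys u)). f m) v"
      by (auto simp: lookup_sum lookup_f less_Suc_eq_le simp del: sum.lessThan_Suc)
  qed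
  ultimately show "u \<in> nichols_ideal q"
    unfolding nichols_ideal_def by blast
qed

section \<open>Closure properties of the defining ideal\<close>

lemma nichols_ideal_0 [simp]: "0 \<in> nichols_ideal q"
  by (simp add: nichols_ideal_iff)

lemma nichols_ideal_add: "u \<in> nichols_ideal q \<Longrightarrow> v \<in> nichols_ideal q \<Longrightarrow> u + v \<in> nichols_ideal q"
  by (simp add: nichols_ideal_iff symmetrizer_value_add)

lemma nichols_ideal_uminus: "u \<in> nichols_ideal q \<Longrightarrow> - u \<in> nichols_ideal q"
  by (simp add: nichols_ideal_iff symmetrizer_value_uminus)

lemma nichols_ideal_diff: "u \<in> nichols_ideal q \<Longrightarrow> v \<in> nichols_ideal q \<Longrightarrow> u - v \<in> nichols_ideal q"
  using nichols_ideal_add[of u q "- v"] nichols_ideal_uminus[of v q] by simp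

lemma nichols_ideal_sum: "(\<And>x. x \<in> X \<Longrightarrow> f x \<in> nichols_ideal q) \<Longrightarrow> (\<Sum>x\<in>X. f x) \<in> nichols_ideal q"
  by (simp add: nichols_ideal_iff symmetrizer_value_sum)

lemma nichols_ideal_scalar: "u \<in> nichols_ideal q \<Longrightarrow> tensor_scalar c * u \<in> nichols_ideal q"
  by (simp add: nichols_ideal_iff symmetrizer_value_scalar)

lemma nichols_ideal_word_mult: "u \<in> nichols_ideal q \<Longrightarrow> tensor_word w * u \<in> nichols_ideal q"
proof (induction w)
  case (Cons i w)
  have "tensor_word [i] * v \<in> nichols_ideal q" if "v \<in> nichols_ideal q" for v
    using that by (auto simp: nichols_ideal_iff symmetrizer_value_letter_mult intro!: sum.neutral)
  then show ?case
    using Cons by (simp add: tensor_word_append[of "[i]" w, simplified] mult.assoc)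
qed simp

lemma nichols_ideal_mult_word: "u \<in> nichols_ideal q \<Longrightarrow> u * tensor_word w \<in> nichols_ideal q"
proof (induction w rule: rev_induct)
  case (snoc i w)
  have "v * tensor_word [i] \<in> nichols_ideal q" if "v \<in> nichols_ideal q" for v
    using that by (auto simp: nichols_ideal_iff symmetrizer_value_mult_letter intro!: sum.neutral)
  then show ?case
    using snoc by (simp add: tensor_word_append flip: mult.assoc)
qed simp

lemma nichols_ideal_mult_left:
  assumes "u \<in> nichols_ideal q"
  shows "v * u \<in> nichols_ideal q"
proof -
  have "linear_extension tensor_word v * u \<in> nichols_ideal q"
    unfolding linear_extension_def sum_distrib_right mult.assoc
    by (intro nichols_ideal_sum nichols_ideal_scalar nichols_ideal_word_mult assms)
  then show ?thesis
    by (simp only: linear_extension_word)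
qed

lemma nichols_ideal_mult_right:
  assumes "u \<in> nichols_ideal q"
  shows "u * v \<in> nichols_ideal q"
proof -
  have "u * (tensor_scalar c * tensor_word w) \<in> nichols_ideal q" for c w
    using nichols_ideal_scalar[OF nichols_ideal_mult_word[OF assms]]
    by (metis mult.assoc tensor_scalar_commute)
  then have "u * linear_extension tensor_word v \<in> nichols_ideal q"
    unfolding linear_extension_def sum_distrib_left by (intro nichols_ideal_sum)
  then show ?thesis
    by (simp only: linear_extension_word)
qed

section \<open>The bracket on the quotient\<close>

lemma linear_extension_superset:
  assumes "finite K" "Poly_Mapping.keys u \<subseteq> K"
  shows "linear_extension f u = (\<Sum>w\<in>K. tensor_scalar (Poly_Mapping.lookup u w) * f w)"
  unfolding linear_extension_def
  by (rule sum.mono_neutral_left[OF assms]) (simp add: in_keys_iff tensor_scalar_def)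

lemma tensor_scalar_add: "tensor_scalar (c + d) = tensor_scalar c + tensor_scalar d"
  by (simp add: tensor_scalar_def single_add)

lemma tensor_scalar_0 [simp]: "tensor_scalar 0 = 0"
  by (simp add: tensor_scalar_def)

lemma tensor_scalar_1 [simp]: "tensor_scalar 1 = 1"
  by (simp add: tensor_scalar_def zero_list_def flip: single_one)

lemma tensor_scalar_mult: "tensor_scalar (c * d) * u = tensor_scalar c * (tensor_scalar d * u)"
  by (rule poly_mapping_eqI) simp

lemma linear_extension_add: "linear_extension f (u + v) = linear_extension f u + linear_extension f v"
proof -
  let ?K = "Poly_Mapping.keys u \<union> Poly_Mapping.keys v"
  have "Poly_Mapping.keys (u + v) \<subseteq> ?K"
    by (rule keys_add)
  then show ?thesis
    by (simp add: linear_extension_superset[of ?K] lookup_add tensor_scalar_add distrib_right sum.distrib)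
qed

lemma linear_extension_tensor_word [simp]: "linear_extension f (tensor_word w) = f w"
  by (simp add: linear_extension_def tensor_word_def)

lemma tensor_bracket_add_left: "tensor_bracket q (u + u') v = tensor_bracket q u v + tensor_bracket q u' v"
  by (simp add: tensor_bracket_def linear_extension_add)

lemma linear_extension_fun_add:
  "linear_extension (\<lambda>w. f w + g w) u = linear_extension f u + linear_extension g u"
  by (simp add: linear_extension_def distrib_left sum.distrib)

lemma tensor_bracket_add_right: "tensor_bracket q u (v + v') = tensor_bracket q u v + tensor_bracket q u v'"
  by (simp add: tensor_bracket_def linear_extension_add linear_extension_fun_add)

lemma tensor_word_homogeneous: "tensor_word w \<in> homogeneous (word_degree w)"
  by (simp add: homogeneous_def tensor_word_def)

lemma tensor_bracket_word:
  "tensor_bracket q (tensor_word x) (tensor_word y) = tensor_word (y @ x)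
    - tensor_scalar (bicharacter q (word_degree y) (word_degree x)) * tensor_word (x @ y)"
  by (simp add: tensor_bracket_homogeneous[OF tensor_word_homogeneous tensor_word_homogeneous]
      tensor_word_append)

lemma tensor_bracket_left_expand:
  "tensor_bracket q u v = (\<Sum>x\<in>Poly_Mapping.keys u.
    tensor_scalar (Poly_Mapping.lookup u x) * tensor_bracket q (tensor_word x) v)"
  by (simp add: tensor_bracket_def linear_extension_def[of _ u])

lemma tensor_bracket_word_right_expand:
  "tensor_bracket q (tensor_word x) v = (\<Sum>y\<in>Poly_Mapping.keys v.
    tensor_scalar (Poly_Mapping.lookup v y) * tensor_bracket q (tensor_word x) (tensor_word y))"
  by (simp add: tensor_bracket_def linear_extension_def[of _ v])

lemma tensor_bracket_expand:
  "tensor_bracket q u v = (\<Sum>x\<in>Poly_Mapping.keys u. \<Sum>y\<in>Poly_Mapping.keys v.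
    tensor_scalar (Poly_Mapping.lookup u x * Poly_Mapping.lookup v y)
      * tensor_bracket q (tensor_word x) (tensor_word y))"
  by (subst tensor_bracket_left_expand, subst tensor_bracket_word_right_expand)
    (simp add: sum_distrib_left tensor_scalar_mult)

lemma tensor_bracket_right_expand:
  "tensor_bracket q u v = (\<Sum>y\<in>Poly_Mapping.keys v.
    tensor_scalar (Poly_Mapping.lookup v y) * tensor_bracket q u (tensor_word y))"
proof -
  have "tensor_bracket q u v = (\<Sum>y\<in>Poly_Mapping.keys v. \<Sum>x\<in>Poly_Mapping.keys u.
      tensor_scalar (Poly_Mapping.lookup u x * Poly_Mapping.lookup v y)
        * tensor_bracket q (tensor_word x) (tensor_word y))"
    by (subst tensor_bracket_expand) (rule sum.swap)
  also have "\<dots> = (\<Sum>y\<in>Poly_Mapping.keys v.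
      tensor_scalar (Poly_Mapping.lookup v y) * tensor_bracket q u (tensor_word y))"
    by (subst (2) tensor_bracket_left_expand)
      (simp add: sum_distrib_left tensor_scalar_mult[symmetric] mult.commute)
  finally show ?thesis .
qed

text \<open>With a bicharacter for \<open>f\<close>, this operator absorbs the degree-dependent
  factor of the bracket, so that bracketing with a word becomes a difference of ordinary
  products.\<close>

definition degree_scaling ::
  "(('i \<Rightarrow> nat) \<Rightarrow> 'a) \<Rightarrow> ('i, 'a::field) tensor_algebra \<Rightarrow> ('i, 'a) tensor_algebra" where
  "degree_scaling f = linear_extension (\<lambda>w. tensor_scalar (f (word_degree w)) * tensor_word w)"

lemma lookup_degree_scaling:
  "Poly_Mapping.lookup (degree_scaling f u) w = f (word_degree w) * Poly_Mapping.lookup u w"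
  by (simp add: degree_scaling_def linear_extension_def lookup_sum tensor_word_def lookup_single
      when_def in_keys_iff if_distrib cong: if_cong)

lemma word_degree_map_permutation:
  assumes "ps \<in> permutations_of_set A"
  shows "word_degree (map w ps) i = card {p \<in> A. w p = i}"
proof -
  have "word_degree (map w ps) i = length (filter (\<lambda>p. w p = i) ps)"
    by (induction ps) (auto simp: word_degree_def)
  also have "\<dots> = card (set (filter (\<lambda>p. w p = i) ps))"
    using permutations_of_setD(2)[OF assms] by (intro distinct_card[symmetric] distinct_filter)
  also have "set (filter (\<lambda>p. w p = i) ps) = {p \<in> A. w p = i}"
    using permutations_of_setD(1)[OF assms] by auto
  finally show ?thesis .
qed

text \<open>All orderings of \<open>A\<close> spell words of the same degree, so each functional is
  merely multiplied by a constant. This expresses the homogeneity of the ideal.\<close>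

lemma nichols_ideal_degree_scaling:
  assumes "u \<in> nichols_ideal q"
  shows "degree_scaling f u \<in> nichols_ideal q"
  unfolding nichols_ideal_iff
proof (intro allI impI)
  fix A :: "nat set" and w :: "nat \<Rightarrow> 'a"
  assume A: "finite A"
  have "word_degree (map w ps) = (\<lambda>i. card {p \<in> A. w p = i})" if "ps \<in> permutations_of_set A" for ps
    using word_degree_map_permutation[OF that] by (intro ext)
  then have "symmetrizer_value q A w (degree_scaling f u)
      = f (\<lambda>i. card {p \<in> A. w p = i}) * symmetrizer_value q A w u"
    by (simp add: symmetrizer_value_def lookup_degree_scaling sum_distrib_left mult.left_commute)
  then show "symmetrizer_value q A w (degree_scaling f u) = 0"
    using assms A by (simp add: nichols_ideal_iff)
qed

lemma tensor_scalar_left_commute: "tensor_scalar c * (u * v) = u * (tensor_scalar c * v)"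
  by (metis mult.assoc tensor_scalar_commute)

lemma tensor_bracket_word_right:
  "tensor_bracket q u (tensor_word y) = tensor_word y * u
    - degree_scaling (bicharacter q (word_degree y)) u * tensor_word y"
  by (simp add: tensor_bracket_def degree_scaling_def linear_extension_diff linear_extension_mult_left
      linear_extension_mult_right linear_extension_word flip: mult.assoc)

lemma tensor_bracket_word_left:
  "tensor_bracket q (tensor_word x) v = v * tensor_word x
    - tensor_word x * degree_scaling (\<lambda>\<beta>. bicharacter q \<beta> (word_degree x)) v"
  by (simp add: tensor_bracket_def degree_scaling_def linear_extension_diff linear_extension_mult_left
      linear_extension_mult_right linear_extension_word tensor_scalar_left_commute)

text \<open>Expanding the other argument in words leaves products with words and degree scalings,
  all of which preserve the ideal.\<close>

lemma nichols_ideal_bracket_left: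
  assumes "u \<in> nichols_ideal q"
  shows "tensor_bracket p u v \<in> nichols_ideal q"
  unfolding tensor_bracket_right_expand[of p u v] tensor_bracket_word_right
  by (intro nichols_ideal_sum nichols_ideal_scalar nichols_ideal_diff nichols_ideal_word_mult
      nichols_ideal_mult_word nichols_ideal_degree_scaling assms)

lemma nichols_ideal_bracket_right:
  assumes "v \<in> nichols_ideal q"
  shows "tensor_bracket p u v \<in> nichols_ideal q"
  unfolding tensor_bracket_left_expand[of p u v] tensor_bracket_word_left
  by (intro nichols_ideal_sum nichols_ideal_scalar nichols_ideal_diff nichols_ideal_word_mult
      nichols_ideal_mult_word nichols_ideal_degree_scaling assms)

section \<open>The quotient ring and its operations on cosets\<close>

lemma tensor_ring_ring: "ring tensor_ring"
proof (rule ringI)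
  show "abelian_group tensor_ring"
    by (rule abelian_groupI) (auto simp: tensor_ring_def ac_simps intro: exI[of _ "- _"])
  show "monoid tensor_ring"
    by (rule monoidI) (auto simp: tensor_ring_def mult.assoc)
qed (auto simp: tensor_ring_def algebra_simps)

lemma nichols_ideal_ideal:
  fixes q :: "'i \<Rightarrow> 'i \<Rightarrow> 'a::field"
  shows "ideal (nichols_ideal q) tensor_ring"
proof (rule idealI[OF tensor_ring_ring])
  interpret ring "tensor_ring :: ('i, 'a) tensor_algebra ring"
    by (rule tensor_ring_ring)
  have "\<ominus>\<^bsub>tensor_ring\<^esub> u = - u" for u :: "('i, 'a) tensor_algebra"
    by (rule minus_equality) (auto simp: tensor_ring_def)
  then show "subgroup (nichols_ideal q) (add_monoid tensor_ring)"
    by (intro add.subgroupI)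
      (auto simp: tensor_ring_def a_inv_def intro: nichols_ideal_add nichols_ideal_uminus nichols_ideal_0)
qed (auto simp: tensor_ring_def intro: nichols_ideal_mult_left nichols_ideal_mult_right)

lemma in_nichols_proj_iff: "v \<in> nichols_proj q u \<longleftrightarrow> v - u \<in> nichols_ideal q"
proof -
  have "v \<in> nichols_proj q u \<longleftrightarrow> (\<exists>h\<in>nichols_ideal q. v = h + u)"
    by (simp add: nichols_proj_def a_r_coset_def' tensor_ring_def)
  then show ?thesis
    by (metis add_diff_cancel diff_add_cancel)
qed

lemma nichols_proj_eq_iff: "nichols_proj q u = nichols_proj q v \<longleftrightarrow> u - v \<in> nichols_ideal q"
proof
  assume "nichols_proj q u = nichols_proj q v"
  then show "u - v \<in> nichols_ideal q"
    by (metis in_nichols_proj_iff nichols_ideal_0 diff_self)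
next
  assume *: "u - v \<in> nichols_ideal q"
  show "nichols_proj q u = nichols_proj q v"
  proof (rule Set.set_eqI)
    fix x
    have "x - v = (x - u) + (u - v)" "x - u = (x - v) - (u - v)"
      by simp_all
    then show "x \<in> nichols_proj q u \<longleftrightarrow> x \<in> nichols_proj q v"
      using * nichols_ideal_add nichols_ideal_diff unfolding in_nichols_proj_iff by metis
  qed
qed

lemma nichols_proj_hom: "nichols_proj q \<in> ring_hom tensor_ring (nichols_algebra q)"
  using ideal.rcos_ring_hom[OF nichols_ideal_ideal, of q] by (simp add: nichols_proj_def[abs_def] nichols_algebra_def)

lemma nichols_add: "nichols_proj q u \<oplus>\<^bsub>nichols_algebra q\<^esub> nichols_proj q v = nichols_proj q (u + v)"
  using ring_hom_add[OF nichols_proj_hom, of u v q] by (simp add: tensor_ring_def)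

lemma nichols_mult: "nichols_proj q u \<otimes>\<^bsub>nichols_algebra q\<^esub> nichols_proj q v = nichols_proj q (u * v)"
  using ring_hom_mult[OF nichols_proj_hom, of u v q] by (simp add: tensor_ring_def)

lemma nichols_zero: "\<zero>\<^bsub>nichols_algebra q\<^esub> = nichols_proj q 0"
proof -
  have "\<zero>\<^bsub>nichols_algebra q\<^esub> = nichols_ideal q"
    by (simp add: nichols_algebra_def FactRing_def)
  also have "\<dots> = nichols_proj q 0"
    by (auto simp: in_nichols_proj_iff)
  finally show ?thesis .
qed

lemma nichols_carrier: "carrier (nichols_algebra q) = range (nichols_proj q)"
  by (auto simp: nichols_algebra_def FactRing_def A_RCOSETS_def' nichols_proj_def tensor_ring_def)

text \<open>Changing representatives changes the bracket by brackets with ideal elements, so the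
  union of cosets defining \<open>nichols_bracket\<close> collapses to a single coset.\<close>

lemma nichols_bracket_proj:
  "nichols_bracket q (nichols_proj q u) (nichols_proj q v) = nichols_proj q (tensor_bracket q u v)"
proof -
  have "nichols_proj q (tensor_bracket q u' v') = nichols_proj q (tensor_bracket q u v)"
    if "u' \<in> nichols_proj q u" "v' \<in> nichols_proj q v" for u' v'
  proof -
    define a b where "a = u' - u" and "b = v' - v"
    have "a \<in> nichols_ideal q" "b \<in> nichols_ideal q" "u' = u + a" "v' = v + b"
      using that by (simp_all add: in_nichols_proj_iff a_def b_def)
    then show ?thesis
      by (simp add: nichols_proj_eq_iff tensor_bracket_add_left tensor_bracket_add_right
          nichols_ideal_add nichols_ideal_bracket_left nichols_ideal_bracket_right)
  qed
  moreover have "x \<in> nichols_proj q x" for x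
    by (simp add: in_nichols_proj_iff)
  ultimately show ?thesis
    unfolding nichols_bracket_def by blast
qed

section \<open>The Lie algebra\<close>

lemma word_degree_append: "word_degree (v @ w) = (\<lambda>i. word_degree v i + word_degree w i)"
  by (simp add: word_degree_def fun_eq_iff)

lemma bicharacter_add_left:
  "bicharacter q (\<lambda>i. \<alpha> i + \<beta> i) \<gamma> = bicharacter q \<alpha> \<gamma> * bicharacter q \<beta> \<gamma>"
  by (simp add: bicharacter_def distrib_right power_add prod.distrib)

lemma bicharacter_add_right:
  "bicharacter q \<alpha> (\<lambda>i. \<beta> i + \<gamma> i) = bicharacter q \<alpha> \<beta> * bicharacter q \<alpha> \<gamma>"
  by (simp add: bicharacter_def distrib_left power_add prod.distrib)

lemma bicharacter_letter [simp]: "bicharacter q (word_degree [i]) (word_degree [j]) = q i j"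
proof -
  have "q k l ^ (word_degree [i] k * word_degree [j] l) = (if l = j then if k = i then q k l else 1 else 1)" for k l
    by (simp add: word_degree_def)
  then show ?thesis
    by (simp add: bicharacter_def)
qed

lemma bicharacter_nonzero: "\<forall>i j. q i j \<noteq> 0 \<Longrightarrow> bicharacter q \<alpha> \<beta> \<noteq> 0"
  by (simp add: bicharacter_def)

lemma lookup_tensor_word: "Poly_Mapping.lookup (tensor_word v) w = (if v = w then 1 else 0)"
  by (simp add: tensor_word_def lookup_single when_def)

lemma lookup_tensor_scalar: "Poly_Mapping.lookup (tensor_scalar c) w = (if w = [] then c else 0)"
  by (auto simp: tensor_scalar_def lookup_single when_def)

lemma nichols_scale: "nichols_scalar q c \<otimes>\<^bsub>nichols_algebra q\<^esub> nichols_proj q u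
    = nichols_proj q (tensor_scalar c * u)"
  by (simp add: nichols_scalar_def nichols_mult)

text \<open>Bounds L(V) from above: it lies in the image of every subspace \<open>M\<close> of the
  tensor algebra that contains V and is closed under the bracket.\<close>

lemma nichols_lie_representative:
  assumes "X \<in> nichols_lie q"
    and "tensor_power 1 \<subseteq> M" "0 \<in> M"
    and "\<And>u v. u \<in> M \<Longrightarrow> v \<in> M \<Longrightarrow> u + v \<in> M"
    and "\<And>c u. u \<in> M \<Longrightarrow> tensor_scalar c * u \<in> M"
    and "\<And>u v. u \<in> M \<Longrightarrow> v \<in> M \<Longrightarrow> tensor_bracket q u v \<in> M"
  shows "\<exists>u\<in>M. X = nichols_proj q u"
  using assms(1)
proof induction
  case (generator v)
  then show ?case
    using assms(2) by blast
next
  case zero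
  then show ?case
    using assms(3) nichols_zero by blast
next
  case (add X Y)
  then show ?case
    using assms(4) nichols_add by metis
next
  case (scale X c)
  then show ?case
    using assms(5) nichols_scale by metis
next
  case (bracket X Y)
  then show ?case
    using assms(6) nichols_bracket_proj by metis
qed

section \<open>Necessity: coefficients of brackets on words of length at most two\<close>

lemma lookup_tensor_bracket:
  "Poly_Mapping.lookup (tensor_bracket q u v) w = (\<Sum>x\<in>Poly_Mapping.keys u. \<Sum>y\<in>Poly_Mapping.keys v.
    Poly_Mapping.lookup u x * Poly_Mapping.lookup v y * ((if y @ x = w then 1 else 0)
      - bicharacter q (word_degree y) (word_degree x) * (if x @ y = w then 1 else 0)))"
  by (subst tensor_bracket_expand)
    (simp add: lookup_sum lookup_minus tensor_bracket_word lookup_tensor_word)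

lemma lookup_tensor_bracket_Nil:
  assumes "Poly_Mapping.lookup u [] = 0"
  shows "Poly_Mapping.lookup (tensor_bracket q u v) [] = 0"
proof -
  have "x \<noteq> []" if "x \<in> Poly_Mapping.keys u" for x
    using that assms by (auto simp: in_keys_iff)
  then show ?thesis
    by (simp add: lookup_tensor_bracket)
qed

lemma nichols_ideal_lookup_Nil: "u \<in> nichols_ideal q \<Longrightarrow> Poly_Mapping.lookup u [] = 0"
proof -
  assume "u \<in> nichols_ideal q"
  then have "symmetrizer_value q {} w u = 0" for w
    by (simp add: nichols_ideal_iff)
  then show ?thesis
    by (simp add: symmetrizer_value_def)
qed

text \<open>This is the functional on the positions \<open>{0, 1}\<close> labelled \<open>i\<close>
  and \<open>j\<close>; the ordering \<open>[1, 0]\<close> has the one inversion, of weight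
  \<open>q j i\<close>.\<close>

lemma nichols_ideal_lookup_pair:
  assumes "u \<in> nichols_ideal q"
  shows "Poly_Mapping.lookup u [i, j] + q j i * Poly_Mapping.lookup u [j, i] = 0"
proof -
  define w where "w p = (if p = 0 then i else j)" for p :: nat
  have "symmetrizer_value q {0, 1} w u = 0"
    using assms by (simp add: nichols_ideal_iff)
  moreover have "{r. r = 0 \<and> r < Suc 0} = {0}" "{r. r = Suc 0 \<and> r < 0} = {}"
    by auto
  ultimately show ?thesis
    by (simp add: symmetrizer_value_def permutations_of_set_doubleton w_def)
qed

text \<open>Without constant terms, words of length two come only from brackets of letters. The
  bracket of \<open>x\<^sub>i\<close> with \<open>x\<^sub>j\<close> contributes
  \<open>q j i - q j i\<close> if \<open>i \<noteq> j\<close>, the reverse one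
  \<open>1 - q i j * q j i\<close>; for \<open>i = j\<close> the contribution is
  \<open>(1 - q i i) * (1 + q i i)\<close>.\<close>

lemma lookup_tensor_bracket_pair:
  assumes u: "Poly_Mapping.lookup u [] = 0" and v: "Poly_Mapping.lookup v [] = 0"
    and q: "q i j * q j i = 1"
  shows "Poly_Mapping.lookup (tensor_bracket q u v) [i, j]
    + q j i * Poly_Mapping.lookup (tensor_bracket q u v) [j, i] = 0"
proof -
  have word: "((if y @ x = [i, j] then 1 else 0)
        - bicharacter q (word_degree y) (word_degree x) * (if x @ y = [i, j] then 1 else 0))
      + q j i * ((if y @ x = [j, i] then 1 else 0)
        - bicharacter q (word_degree y) (word_degree x) * (if x @ y = [j, i] then 1 else 0)) = 0"
    (is "?f x y + q j i * ?g x y = 0") if "x \<noteq> []" "y \<noteq> []" for x y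
  proof (cases "(x = [i] \<and> y = [j]) \<or> (x = [j] \<and> y = [i])")
    case True
    moreover have "q j i * q i j = 1"
      using q by (simp add: mult.commute)
    ultimately show ?thesis
      using q by (elim disjE conjE; cases "i = j") (simp_all add: right_diff_distrib)
  next
    case False
    then have "y @ x \<noteq> [i, j]" "x @ y \<noteq> [i, j]" "y @ x \<noteq> [j, i]" "x @ y \<noteq> [j, i]"
      using that by (auto simp: append_eq_Cons_conv)
    then show ?thesis
      by simp
  qed
  have "x \<noteq> []" if "x \<in> Poly_Mapping.keys u" for x
    using that u by (auto simp: in_keys_iff)
  moreover have "y \<noteq> []" if "y \<in> Poly_Mapping.keys v" for y
    using that v by (auto simp: in_keys_iff)
  ultimately have "(\<Sum>x\<in>Poly_Mapping.keys u. \<Sum>y\<in>Poly_Mapping.keys v.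
      Poly_Mapping.lookup u x * Poly_Mapping.lookup v y * (?f x y + q j i * ?g x y)) = 0"
    by (intro sum.neutral ballI) (simp add: word)
  then show ?thesis
    unfolding lookup_tensor_bracket sum_distrib_left sum.distrib[symmetric]
    by (simp add: distrib_left mult.left_commute)
qed

lemma lookup_tensor_power: "u \<in> tensor_power m \<Longrightarrow> length w \<noteq> m \<Longrightarrow> Poly_Mapping.lookup u w = 0"
  by (auto simp: tensor_power_def in_keys_iff)

lemma nichols_lie_lookup_Nil:
  assumes "X \<in> nichols_lie q"
  obtains u where "X = nichols_proj q u" "Poly_Mapping.lookup u [] = 0"
proof -
  have "\<exists>u\<in>{u. Poly_Mapping.lookup u [] = 0}. X = nichols_proj q u"
    by (rule nichols_lie_representative[OF assms])
      (auto simp: lookup_tensor_power lookup_add lookup_tensor_bracket_Nil)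
  then show thesis
    using that by blast
qed

text \<open>Both conditions of the theorem are covered at once: for \<open>i = j\<close> the
  assumption \<open>q i i = 1\<close> is refuted, since it would make the product equal to
  1.\<close>

lemma internal_direct_sum_imp_pair:
  fixes q :: "'i::finite \<Rightarrow> 'i \<Rightarrow> 'a::field_char_0"
  assumes sum: "internal_direct_sum (nichols_algebra q) (range (nichols_scalar q)) (nichols_lie q)"
    and ij: "i \<noteq> j \<or> q i i = 1"
  shows "q i j * q j i \<noteq> 1"
proof
  assume q: "q i j * q j i = 1"
  define \<phi> where "\<phi> u = Poly_Mapping.lookup u [i, j] + q j i * Poly_Mapping.lookup u [j, i]"
    for u :: "('i, 'a) tensor_algebra"
  have \<phi>_add: "\<phi> (u + v) = \<phi> u + \<phi> v" for u v
    by (simp add: \<phi>_def lookup_add distrib_left)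
  have \<phi>_scalar: "\<phi> (tensor_scalar c * u) = c * \<phi> u" for c u
    by (simp add: \<phi>_def distrib_left mult.left_commute)
  \<comment> \<open>The constant term must vanish as well, because the computation of
    \<open>\<phi>\<close> on brackets relies on it.\<close>
  let ?M = "{u. Poly_Mapping.lookup u [] = 0 \<and> \<phi> u = 0}"
  have M: "\<exists>u\<in>?M. X = nichols_proj q u" if "X \<in> nichols_lie q" for X
  proof (rule nichols_lie_representative[OF that])
    show "tensor_power 1 \<subseteq> ?M"
      by (auto simp: \<phi>_def lookup_tensor_power)
    show "tensor_bracket q u v \<in> ?M" if "u \<in> ?M" "v \<in> ?M" for u v
      using that lookup_tensor_bracket_Nil[of u q v] lookup_tensor_bracket_pair[of u v q i j] q
      by (simp add: \<phi>_def)
  qed (auto simp: \<phi>_add \<phi>_scalar lookup_add \<phi>_def[of 0])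
  have "nichols_proj q (tensor_word [i, j]) \<in> carrier (nichols_algebra q)"
    by (simp add: nichols_carrier)
  then obtain c X where X: "X \<in> nichols_lie q"
    "nichols_proj q (tensor_word [i, j]) = nichols_scalar q c \<oplus>\<^bsub>nichols_algebra q\<^esub> X"
    using sum by (auto simp: internal_direct_sum_def set_add_def')
  obtain u where u: "u \<in> ?M" "X = nichols_proj q u"
    using M[OF X(1)] by blast
  have "tensor_word [i, j] - (tensor_scalar c + u) \<in> nichols_ideal q"
    using X(2) by (simp add: u(2) nichols_scalar_def nichols_add nichols_proj_eq_iff)
  then have "\<phi> (tensor_word [i, j] - (tensor_scalar c + u)) = 0"
    unfolding \<phi>_def by (rule nichols_ideal_lookup_pair)
  moreover have "\<phi> (tensor_scalar c + u) = 0"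
    using u by (simp add: \<phi>_add \<phi>_def[of "tensor_scalar c"] lookup_tensor_scalar)
  moreover have "\<phi> (tensor_word [i, j] - (tensor_scalar c + u)) + \<phi> (tensor_scalar c + u)
      = \<phi> (tensor_word [i, j])"
    by (simp flip: \<phi>_add)
  ultimately have "\<phi> (tensor_word [i, j]) = 0"
    by simp
  \<comment> \<open>The value of \<open>\<phi>\<close> on this word is \<open>1\<close> if
    \<open>i \<noteq> j\<close>, and \<open>1 + q i i = 2\<close> if \<open>i = j\<close>, which is
    nonzero in characteristic zero.\<close>
  then show False
    using ij by (cases "i = j") (auto simp: \<phi>_def lookup_tensor_word)
qed

section \<open>Sufficiency: computing in the preimage of L(V) in the tensor algebra\<close>

definition lie_lift :: "('i::finite \<Rightarrow> 'i \<Rightarrow> 'a::field) \<Rightarrow> ('i, 'a) tensor_algebra set" where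
  "lie_lift q = {u. nichols_proj q u \<in> nichols_lie q}"

lemma lie_lift_tensor_power: "v \<in> tensor_power 1 \<Longrightarrow> v \<in> lie_lift q"
  by (simp add: lie_lift_def nichols_lie.generator)

lemma lie_lift_0: "0 \<in> lie_lift q"
  using nichols_lie.zero by (simp add: lie_lift_def nichols_zero)

lemma lie_lift_add: "u \<in> lie_lift q \<Longrightarrow> v \<in> lie_lift q \<Longrightarrow> u + v \<in> lie_lift q"
  using nichols_lie.add by (fastforce simp: lie_lift_def nichols_add)

lemma lie_lift_scalar: "u \<in> lie_lift q \<Longrightarrow> tensor_scalar c * u \<in> lie_lift q"
  using nichols_lie.scale by (fastforce simp: lie_lift_def nichols_scale)

lemma lie_lift_bracket: "u \<in> lie_lift q \<Longrightarrow> v \<in> lie_lift q \<Longrightarrow> tensor_bracket q u v \<in> lie_lift q"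
  using nichols_lie.bracket by (fastforce simp: lie_lift_def nichols_bracket_proj)

lemma lie_lift_diff: "u \<in> lie_lift q \<Longrightarrow> v \<in> lie_lift q \<Longrightarrow> u - v \<in> lie_lift q"
proof -
  have "u - v = u + tensor_scalar (- 1) * v"
    by (rule poly_mapping_eqI) (simp add: lookup_add lookup_minus)
  then show "u \<in> lie_lift q \<Longrightarrow> v \<in> lie_lift q \<Longrightarrow> ?thesis"
    by (metis lie_lift_add lie_lift_scalar)
qed

lemma lie_lift_sum: "(\<And>x. x \<in> X \<Longrightarrow> f x \<in> lie_lift q) \<Longrightarrow> (\<Sum>x\<in>X. f x) \<in> lie_lift q"
  by (induction X rule: infinite_finite_induct) (auto intro: lie_lift_0 lie_lift_add)

lemma lie_lift_ideal:
  assumes "u \<in> nichols_ideal q"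
  shows "u \<in> lie_lift q"
proof -
  have "nichols_proj q u = nichols_proj q 0"
    using assms by (simp add: nichols_proj_eq_iff)
  then show ?thesis
    using lie_lift_0 by (simp add: lie_lift_def)
qed

lemma lie_lift_scalar_cancel:
  assumes "tensor_scalar c * u \<in> lie_lift q" "c \<noteq> 0"
  shows "u \<in> lie_lift q"
proof -
  have "u = tensor_scalar (inverse c) * (tensor_scalar c * u)"
    by (rule poly_mapping_eqI) (simp add: assms(2))
  then show ?thesis
    using lie_lift_scalar[OF assms(1)] by metis
qed

text \<open>Only sets of two positions see a word of length two; if both are labelled
  \<open>i\<close>, the two orderings contribute \<open>1 + q i i = 0\<close>.\<close>

lemma square_in_nichols_ideal:
  fixes q :: "'i \<Rightarrow> 'i \<Rightarrow> 'a::field"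
  assumes "q i i = - 1"
  shows "tensor_word [i, i] \<in> nichols_ideal q"
  unfolding nichols_ideal_iff
proof (intro allI impI)
  fix A :: "nat set" and w :: "nat \<Rightarrow> 'i"
  show "symmetrizer_value q A w (tensor_word [i, i]) = 0"
  proof (cases "card A = 2")
    case True
    then obtain a b where ab: "A = {a, b}" "a < b"
      by (metis card_2_iff insert_commute linorder_neqE_nat)
    have "{r. r = x \<and> r < y} = (if x < y then {x} else {})" for x y :: nat
      by auto
    then show ?thesis
      using ab assms by (cases "w a = i"; cases "w b = i") (simp_all add: symmetrizer_value_def permutations_of_set_doubleton lookup_tensor_word)
  next
    case False
    have "symmetrizer_value q A w (tensor_word [i, i]) = symmetrizer_value q A w 0"
      by (rule symmetrizer_value_cong) (use False in \<open>auto simp: lookup_tensor_word\<close>)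
    then show ?thesis
      by simp
  qed
qed

lemma tensor_word_in_lie_lift:
  fixes q :: "'i::finite \<Rightarrow> 'i \<Rightarrow> 'a::field"
  assumes nz: "\<forall>i j. q i j \<noteq> 0" and q: "\<And>i j. i \<noteq> j \<Longrightarrow> q i j * q j i \<noteq> 1" "\<And>i. q i i \<noteq> 1"
    and "w \<noteq> []"
  shows "tensor_word w \<in> lie_lift q"
  using \<open>w \<noteq> []\<close>
proof (induction "length w" arbitrary: w rule: less_induct)
  case less
  show ?case
  proof (cases "length w = 1")
    case True
    then show ?thesis
      by (intro lie_lift_tensor_power) (simp add: tensor_power_def tensor_word_def)
  next
    case False
    then obtain i j v where w: "w = [i, j] @ v"
      using less.prems by (cases w; cases "tl w") auto
    show ?thesis
    proof (cases "q i j * q j i = 1")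
      case True
      then have "i = j"
        using q(1) by blast
      \<comment> \<open>Here \<open>q i i\<close> squares to 1 and differs from 1.\<close>
      then have "q i i = - 1"
        using True q(2)[of i] by (metis power2_eq_1_iff power2_eq_square)
      then have "tensor_word w \<in> nichols_ideal q"
        using nichols_ideal_mult_word[OF square_in_nichols_ideal] \<open>i = j\<close>
        by (simp only: w tensor_word_append)
      then show ?thesis
        by (rule lie_lift_ideal)
    next
      case ne: False
      let ?W = "\<lambda>w. tensor_word w :: ('i, 'a) tensor_algebra"
      let ?p = "\<lambda>v w. bicharacter q (word_degree v) (word_degree w)"
      \<comment> \<open>Both factors are nonempty, hence shorter than \<open>w\<close> and covered
        by the induction hypothesis.\<close>
      have bracket: "?W (y @ x) - tensor_scalar (?p y x) * ?W (x @ y) \<in> lie_lift q"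
        if "x \<noteq> []" "y \<noteq> []" "length x + length y = length w" for x y
      proof -
        have "length x < length w" "length y < length w"
          using that(1,2) unfolding that(3)[symmetric] by simp_all
        then show ?thesis
          using that(1,2) lie_lift_bracket[OF less.hyps[of x] less.hyps[of y]]
          by (simp add: tensor_bracket_word)
      qed
      show ?thesis
      proof (cases "v = []")
        case True
        have "?W [j, i] - tensor_scalar (q j i) * ?W [i, j] \<in> lie_lift q"
          and "?W [i, j] - tensor_scalar (q i j) * ?W [j, i] \<in> lie_lift q"
          using bracket[of "[i]" "[j]"] bracket[of "[j]" "[i]"] by (simp_all add: w True)
        \<comment> \<open>With \<open>v\<close> empty, the rotation of the other case would bracket
          with the empty word. Instead the two brackets of the letters are combined so that
          \<open>[j, i]\<close> cancels.\<close>
        then have "(?W [i, j] - tensor_scalar (q i j) * ?W [j, i])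
            + tensor_scalar (q i j) * (?W [j, i] - tensor_scalar (q j i) * ?W [i, j]) \<in> lie_lift q"
          by (intro lie_lift_add lie_lift_scalar)
        also have "(?W [i, j] - tensor_scalar (q i j) * ?W [j, i])
            + tensor_scalar (q i j) * (?W [j, i] - tensor_scalar (q j i) * ?W [i, j])
            = tensor_scalar (1 - q i j * q j i) * ?W [i, j]"
          by (rule poly_mapping_eqI) (simp add: lookup_add lookup_minus algebra_simps)
        finally show ?thesis
          using ne by (simp add: w True lie_lift_scalar_cancel)
      next
        case False
        let ?B = "\<lambda>x y. ?W (y @ x) - tensor_scalar (?p y x) * ?W (x @ y)"
        \<comment> \<open>\<open>?B [i, j] v\<close> moves both letters past \<open>v\<close> at
          once, the other two brackets move them one after the other. The terms in
          \<open>v @ [i, j]\<close> and \<open>[j] @ v @ [i]\<close> cancel, leaving a multiple of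
          \<open>w\<close>.\<close>
        have "?B [i, j] v - ?B [j] (v @ [i]) - tensor_scalar (?p (v @ [i]) [j]) * ?B [i] ([j] @ v) \<in> lie_lift q"
          using False by (intro lie_lift_diff lie_lift_scalar bracket) (simp_all add: w)
        also have "?B [i, j] v - ?B [j] (v @ [i]) - tensor_scalar (?p (v @ [i]) [j]) * ?B [i] ([j] @ v)
            = tensor_scalar (?p (v @ [i]) [j] * ?p ([j] @ v) [i] - ?p v ([i] @ [j])) * ?W w"
          by (rule poly_mapping_eqI) (simp add: w lookup_minus algebra_simps)
        also have "?p (v @ [i]) [j] * ?p ([j] @ v) [i] - ?p v ([i] @ [j])
            = ?p v [i] * ?p v [j] * (q i j * q j i - 1)"
          unfolding word_degree_append bicharacter_add_left bicharacter_add_right bicharacter_letter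
          by (simp add: algebra_simps)
        finally show ?thesis
          by (rule lie_lift_scalar_cancel) (use ne bicharacter_nonzero[OF nz] in simp)
      qed
    qed
  qed
qed

text \<open>Subtracting the constant term leaves a combination of nonempty words. The sum is direct
  because the constant term is well defined on cosets and vanishes on L(V).\<close>

lemma internal_direct_sum_nichols_lie:
  fixes q :: "'i::finite \<Rightarrow> 'i \<Rightarrow> 'a::field"
  assumes word: "\<And>w. w \<noteq> [] \<Longrightarrow> tensor_word w \<in> lie_lift q"
  shows "internal_direct_sum (nichols_algebra q) (range (nichols_scalar q)) (nichols_lie q)"
  unfolding internal_direct_sum_def
proof
  have plus: "X \<in> range (nichols_scalar q) <+>\<^bsub>nichols_algebra q\<^esub> nichols_lie q \<longleftrightarrow>
      (\<exists>c. \<exists>Y\<in>nichols_lie q. X = nichols_scalar q c \<oplus>\<^bsub>nichols_algebra q\<^esub> Y)" for X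
    by (auto simp: set_add_def')
  show "carrier (nichols_algebra q) = range (nichols_scalar q) <+>\<^bsub>nichols_algebra q\<^esub> nichols_lie q"
    unfolding nichols_carrier
  proof (intro equalityI subsetI)
    fix X
    assume "X \<in> range (nichols_proj q)"
    then obtain u where u: "X = nichols_proj q u"
      by blast
    define c where "c = Poly_Mapping.lookup u []"
    have "linear_extension tensor_word (u - tensor_scalar c) \<in> lie_lift q"
      unfolding linear_extension_def
    proof (intro lie_lift_sum lie_lift_scalar word)
      fix w
      assume "w \<in> Poly_Mapping.keys (u - tensor_scalar c)"
      then show "w \<noteq> []"
        by (auto simp: in_keys_iff lookup_minus lookup_tensor_scalar c_def)
    qed
    then have "nichols_proj q (u - tensor_scalar c) \<in> nichols_lie q"
      by (simp only: linear_extension_word lie_lift_def mem_Collect_eq)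
    moreover have "X = nichols_scalar q c \<oplus>\<^bsub>nichols_algebra q\<^esub> nichols_proj q (u - tensor_scalar c)"
      by (simp add: u nichols_scalar_def nichols_add)
    ultimately show "X \<in> range (nichols_scalar q) <+>\<^bsub>nichols_algebra q\<^esub> nichols_lie q"
      unfolding plus by blast
  next
    fix X
    assume "X \<in> range (nichols_scalar q) <+>\<^bsub>nichols_algebra q\<^esub> nichols_lie q"
    then obtain c Y where X: "X = nichols_scalar q c \<oplus>\<^bsub>nichols_algebra q\<^esub> Y" "Y \<in> nichols_lie q"
      unfolding plus by blast
    then obtain u where "Y = nichols_proj q u"
      using nichols_lie_lookup_Nil by blast
    then show "X \<in> range (nichols_proj q)"
      by (simp add: X(1) nichols_scalar_def nichols_add)
  qed
next
  have "c = 0" if c: "nichols_scalar q c \<in> nichols_lie q" for c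
  proof -
    obtain u where u: "nichols_scalar q c = nichols_proj q u" "Poly_Mapping.lookup u [] = 0"
      using nichols_lie_lookup_Nil[OF c] by blast
    then have "tensor_scalar c - u \<in> nichols_ideal q"
      by (simp add: nichols_scalar_def nichols_proj_eq_iff)
    then show ?thesis
      using nichols_ideal_lookup_Nil u(2) by (fastforce simp: lookup_minus lookup_tensor_scalar)
  qed
  moreover have "nichols_scalar q 0 = \<zero>\<^bsub>nichols_algebra q\<^esub>"
    by (simp add: nichols_scalar_def nichols_zero)
  ultimately show "range (nichols_scalar q) \<inter> nichols_lie q = {\<zero>\<^bsub>nichols_algebra q\<^esub>}"
    using nichols_lie.zero[of q] by force
qed

theorem theorem3p5:
  fixes q :: "'i::finite \<Rightarrow> 'i \<Rightarrow> 'a::field_char_0"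
  assumes "CARD('i) > 1"
    and "\<forall>i j. q i j \<noteq> 0"
    and "connected_diagram q"
  shows "complete_diagram q \<and> (\<forall>i. q i i \<noteq> 1) \<longleftrightarrow>
    internal_direct_sum (nichols_algebra q) (range (nichols_scalar q)) (nichols_lie q)"
proof
  assume "complete_diagram q \<and> (\<forall>i. q i i \<noteq> 1)"
  then show "internal_direct_sum (nichols_algebra q) (range (nichols_scalar q)) (nichols_lie q)"
    using assms(2) by (intro internal_direct_sum_nichols_lie tensor_word_in_lie_lift)
      (auto simp: complete_diagram_def dynkin_edge_def)
next
  assume sum: "internal_direct_sum (nichols_algebra q) (range (nichols_scalar q)) (nichols_lie q)"
  show "complete_diagram q \<and> (\<forall>i. q i i \<noteq> 1)"
    \<comment> \<open>Distinct indices give the edges; for equal ones, \<open>q i i = 1\<close>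
      would turn the product \<open>q i i * q i i\<close> into 1.\<close>
    using internal_direct_sum_imp_pair[OF sum]
    by (metis complete_diagram_def dynkin_edge_def mult_1)
qed

end
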